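(* Let $\mathcal M$ be the local center manifold at the origin of the reduced system defined in the context. Consider a non-equilibrium trajectory in $\mathcal M$, staying near the origin, that converges to a degenerate configuration, i.e. whose $Z$-component converges to some $Z_\star$ with $Z_{\star,U}=Z_{\star,L}=0$. Then the rate of convergence is no faster than $1/\sqrt t$: there is a constant $c>0$ such that $$|Z(t)-Z_\star|\ \ge\ \frac{c}{\sqrt t}\qquad\text{for all sufficiently large } t.$$
   Context: Let $n=2N$ and let $\mathrm a>0$ be a real parameter. $\mathbf 1_p$ is the all-ones vector in $\mathbb R^p$, $X=(1,\dots,1,-1,\dots,-1)^T=\mathrm{col}(\mathbf 1_N,-\mathbf 1_N)\in\mathbb R^n$. Fix an $N\times(N-1)$ matrix $V$ whose columns form a basis of $\{v\in\mathbb R^N: v^T\mathbf 1_N=0\}$, and set $$\mathbb V=\begin{bmatrix}V&0&\mathbf 1_N\\0&V&\mathbf 1_N\end{bmatrix}\in\mathbb R^{n\times(n-1)},\qquad [\mathbb V\ \ X]^{-1}=\begin{bmatrix}\mathbb T\\ \frac1nX^T\end{bmatrix},$$ so $\mathbb T$ is $(n-1)\times n$. Squares of vectors and $\odot$ are entrywise. The variables of the reduced system are $Z,\beta,\beta_\Diamond,\beta_\ast\in\mathbb R^{n-1}$ and $\gamma=(\gamma_1,\gamma_2)\in\mathbb R^2$. Put $$\mathbf c=\mathbb V\beta+\mathbb V\beta_\ast-\mathrm a\gamma_1X,\qquad \mathbf s=-\mathbb VZ+\tfrac12\mathbb V\beta_\Diamond+(\mathrm a^2\gamma_1+\mathrm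 a\gamma_2)X,$$ $$\mathcal U=-\mathbf s\odot\big((\mathbf c+\mathbf 1_n)^2+\mathbf s^2-\mathbf 1_n\big),\qquad \mathcal W=-(\mathbf c+\mathbf 1_n)\odot\big((\mathbf c+\mathbf 1_n)^2+\mathbf s^2-\mathbf 1_n\big)+2\mathbf c.$$ The reduced system is $$\dot Z=-\tfrac{\mathrm a}2\mathbb T\mathcal U,\quad \dot\beta=\beta_\Diamond,\quad \dot\beta_\Diamond=2\beta_\ast+\mathrm a\mathbb T\mathcal U,\quad \dot\beta_\ast=-2\mathrm a\beta-2\beta_\Diamond-2\mathrm a\beta_\ast+\mathrm a\mathbb T\mathcal W,$$ $$\dot\gamma_1=-\mathrm a\gamma_1+\gamma_2-\tfrac1nX^T\mathcal W,\qquad \dot\gamma_2=(\mathrm a^2-1)\gamma_1-\mathrm a\gamma_2+\tfrac1nX^T(\mathcal U+\mathrm a\mathcal W).$$ At the origin $Z$ spans the center directions and $Y=(\beta,\beta_\Diamond,\beta_\ast,\gamma)$ the stable ones; $\mathcal M$ is locally a graph $Y=h(Z)$, invariant, with $h(0)=0$, $\nabla h(0)=0$. For $Z=(z_1,\dots,z_{n-1})^T$: $Z_U=(z_1,\dots,z_{N-1})^T$, $Z_L=(z_N,\dots,z_{2N-2})^T$. *)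

theory Defs
  imports "HOL-Analysis.Analysis"
begin

text \<open>
  With N = CARD('N), R^n = R^(2N) is rendered as \<open>real^('N + 'N)\<close>: \<open>Inl\<close> indexes the first N
  coordinates and \<open>Inr\<close> the last N. The space R^(n-1) is \<open>real^'p\<close>, where
  \<open>e :: 'p \<Rightarrow> nat\<close> is a numbering of the coordinates by 1,...,2N-1, so that the coordinate
  z_k of \<open>Z\<close> is \<open>Z $ p\<close> with \<open>e p = k\<close>. (An index type of cardinality N-1
  would exclude N = 1.)
  The matrix V is the family \<open>v\<close> of its columns \<open>v 1, ..., v (N-1)\<close>.
  On \<open>real^_\<close> the library's \<open>*\<close>, \<open>^\<close> and \<open>1\<close> are entrywise: \<open>x * y\<close> is the entrywise product,
  \<open>x\<^sup>2\<close> the entrywise square and \<open>1\<close> the all-ones vector.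
\<close>

definition coord_numbering :: "'N::finite itself \<Rightarrow> ('p::finite \<Rightarrow> nat) \<Rightarrow> bool" where
  "coord_numbering _ e \<longleftrightarrow> bij_betw e UNIV {1 .. 2 * CARD('N) - 1}"

definition zero_sum_basis :: "(nat \<Rightarrow> real^'N) \<Rightarrow> bool" where
  "zero_sum_basis v \<longleftrightarrow>
     inj_on v {1 .. CARD('N) - 1} \<and>
     independent (v ` {1 .. CARD('N) - 1}) \<and>
     span (v ` {1 .. CARD('N) - 1}) = {w. w \<bullet> 1 = 0}"

definition Xvec :: "real^('N::finite + 'N)" where
  "Xvec = (\<chi> i. case i of Inl _ \<Rightarrow> 1 | Inr _ \<Rightarrow> -1)"

definition VV :: "('p::finite \<Rightarrow> nat) \<Rightarrow> (nat \<Rightarrow> real^'N::finite) \<Rightarrow> real^'p^('N + 'N)" where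
  "VV e v = (\<chi> i p.
     if e p \<le> CARD('N) - 1 then (case i of Inl j \<Rightarrow> v (e p) $ j | Inr _ \<Rightarrow> 0)
     else if e p \<le> 2 * CARD('N) - 2 then
       (case i of Inl _ \<Rightarrow> 0 | Inr j \<Rightarrow> v (e p - (CARD('N) - 1)) $ j)
     else 1)"

text \<open>
  \<open>VVX B\<close> is the square matrix [B X], the column X having index \<open>None\<close>. For \<open>B = VV e v\<close> the
  row \<open>None\<close> of its inverse is X^T/n, because X is orthogonal to the columns of B; the remaining
  rows form the matrix T.
\<close>

definition VVX :: "real^'p::finite^('N::finite + 'N) \<Rightarrow> real^('p option)^('N + 'N)" where
  "VVX B = (\<chi> i q. case q of Some p \<Rightarrow> B $ i $ p | None \<Rightarrow> Xvec $ i)"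

definition TT :: "real^'p::finite^('N::finite + 'N) \<Rightarrow> real^('N + 'N)^'p" where
  "TT B = (\<chi> p. matrix_inv (VVX B) $ Some p)"

text \<open>A state is \<open>(Z, Y)\<close> with \<open>Y = (\<beta>, \<beta>\<^sub>d, \<beta>\<^sub>s, \<gamma>\<^sub>1, \<gamma>\<^sub>2)\<close>;
  the subscripts d and s stand for diamond and star.\<close>

type_synonym 'p stable = "(real^'p) \<times> (real^'p) \<times> (real^'p) \<times> real \<times> real"
type_synonym 'p state = "(real^'p) \<times> 'p stable"

definition cvec :: "real \<Rightarrow> real^'p::finite^('N::finite + 'N) \<Rightarrow> 'p state \<Rightarrow> real^('N + 'N)" where
  "cvec a B = (\<lambda>(Z, \<beta>, \<beta>\<^sub>d, \<beta>\<^sub>s, \<gamma>\<^sub>1, \<gamma>\<^sub>2).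
     B *v \<beta> + B *v \<beta>\<^sub>s - (a * \<gamma>\<^sub>1) *\<^sub>R Xvec)"

definition svec :: "real \<Rightarrow> real^'p::finite^('N::finite + 'N) \<Rightarrow> 'p state \<Rightarrow> real^('N + 'N)" where
  "svec a B = (\<lambda>(Z, \<beta>, \<beta>\<^sub>d, \<beta>\<^sub>s, \<gamma>\<^sub>1, \<gamma>\<^sub>2).
     - (B *v Z) + (1/2) *\<^sub>R (B *v \<beta>\<^sub>d) + (a\<^sup>2 * \<gamma>\<^sub>1 + a * \<gamma>\<^sub>2) *\<^sub>R Xvec)"

definition UU :: "real \<Rightarrow> real^'p::finite^('N::finite + 'N) \<Rightarrow> 'p state \<Rightarrow> real^('N + 'N)" where
  "UU a B \<xi> = - svec a B \<xi> * ((cvec a B \<xi> + 1)\<^sup>2 + (svec a B \<xi>)\<^sup>2 - 1)"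

definition WW :: "real \<Rightarrow> real^'p::finite^('N::finite + 'N) \<Rightarrow> 'p state \<Rightarrow> real^('N + 'N)" where
  "WW a B \<xi> = - (cvec a B \<xi> + 1) * ((cvec a B \<xi> + 1)\<^sup>2 + (svec a B \<xi>)\<^sup>2 - 1)
               + 2 *\<^sub>R cvec a B \<xi>"

definition reduced_field ::
    "real \<Rightarrow> real^'p::finite^('N::finite + 'N) \<Rightarrow> 'p state \<Rightarrow> 'p state" where
  "reduced_field a B = (\<lambda>(Z, \<beta>, \<beta>\<^sub>d, \<beta>\<^sub>s, \<gamma>\<^sub>1, \<gamma>\<^sub>2).
     let U = UU a B (Z, \<beta>, \<beta>\<^sub>d, \<beta>\<^sub>s, \<gamma>\<^sub>1, \<gamma>\<^sub>2);
         W = WW a B (Z, \<beta>, \<beta>\<^sub>d, \<beta>\<^sub>s, \<gamma>\<^sub>1, \<gamma>\<^sub>2);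
         n = real CARD('N + 'N)
     in (- (a / 2) *\<^sub>R (TT B *v U),
         \<beta>\<^sub>d,
         2 *\<^sub>R \<beta>\<^sub>s + a *\<^sub>R (TT B *v U),
         - (2 * a) *\<^sub>R \<beta> - 2 *\<^sub>R \<beta>\<^sub>d - (2 * a) *\<^sub>R \<beta>\<^sub>s + a *\<^sub>R (TT B *v W),
         - a * \<gamma>\<^sub>1 + \<gamma>\<^sub>2 - (1 / n) * (Xvec \<bullet> W),
         (a\<^sup>2 - 1) * \<gamma>\<^sub>1 - a * \<gamma>\<^sub>2 + (1 / n) * (Xvec \<bullet> (U + a *\<^sub>R W))))"

definition trajectory_on ::
    "('s::real_normed_vector \<Rightarrow> 's) \<Rightarrow> (real \<Rightarrow> 's) \<Rightarrow> real set \<Rightarrow> bool" where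
  "trajectory_on F x I \<longleftrightarrow> (\<forall>t\<in>I. (x has_vector_derivative F (x t)) (at t within I))"

definition locally_invariant ::
    "('s::real_normed_vector \<Rightarrow> 's) \<Rightarrow> 's set \<Rightarrow> bool" where
  "locally_invariant F M \<longleftrightarrow>
     (\<forall>\<xi>\<in>M. \<exists>\<tau>>0. \<exists>x. x 0 = \<xi> \<and> trajectory_on F x {-\<tau><..<\<tau>} \<and> (\<forall>t\<in>{-\<tau><..<\<tau>}. x t \<in> M))"

definition graph_on :: "'z set \<Rightarrow> ('z \<Rightarrow> 'y) \<Rightarrow> ('z \<times> 'y) set" where
  "graph_on D h = {(Z, h Z) | Z. Z \<in> D}"

text \<open>Here the first factor consists of the center directions of \<open>F\<close> at the origin and the
  second one of the stable directions.\<close>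

definition local_center_manifold ::
    "('z::real_normed_vector \<times> 'y::real_normed_vector \<Rightarrow> 'z \<times> 'y) \<Rightarrow> ('z \<times> 'y) set \<Rightarrow> bool" where
  "local_center_manifold F M \<longleftrightarrow>
     (\<exists>D h. M = graph_on D h \<and> open D \<and> 0 \<in> D \<and>
       (\<exists>h' :: 'z \<Rightarrow> 'z \<Rightarrow>\<^sub>L 'y.
          (\<forall>Z\<in>D. (h has_derivative blinfun_apply (h' Z)) (at Z)) \<and>
          continuous_on D h' \<and> h' 0 = 0) \<and>
       h 0 = 0 \<and>
       locally_invariant F M)"

definition equilibrium :: "('s::real_normed_vector \<Rightarrow> 's) \<Rightarrow> 's \<Rightarrow> bool" where
  "equilibrium F \<xi> \<longleftrightarrow> F \<xi> = 0"

text \<open>Z_U = (z_1,...,z_(N-1)) and Z_L = (z_N,...,z_(2N-2)) both vanish.\<close>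

definition degenerate_config ::
    "'N::finite itself \<Rightarrow> ('p::finite \<Rightarrow> nat) \<Rightarrow> real^'p \<Rightarrow> bool" where
  "degenerate_config _ e Z \<longleftrightarrow>
     (\<forall>p. e p \<in> {1 .. CARD('N) - 1} \<longrightarrow> Z $ p = 0) \<and>
     (\<forall>p. e p \<in> {CARD('N) .. 2 * CARD('N) - 2} \<longrightarrow> Z $ p = 0)"

end

theory Submission
  imports Defs
begin

text \<open>Write \<open>w = (c + 1) + i s\<close> for the vector of points in the plane. In terms of \<open>w\<close> and a second complex
  vector \<open>m\<close> (\<open>mre\<close>, \<open>mim\<close>) the reduced system becomes \<open>w' = i m - a w \<rho>\<close>, \<open>m' = i (2 m - P m) - a w \<rho>\<close>,
  where \<open>\<rho> = |w|\<^sup>2 - 1\<close> and P is the projection onto X (lemma \<open>field_state\<close>). This form is invariant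
  under multiplication of \<open>w\<close> and \<open>m\<close> by a common phase. The limit of the trajectory is an equilibrium, and a
  degenerate equilibrium near the origin has all \<open>w\<^sub>j\<close> equal to one point of the unit circle and
  \<open>m = 0\<close> (\<open>degenerate_equilibrium\<close>), so that after a rotation it is the origin.

  Let \<open>p\<close> and \<open>q\<close> be the radial and tangential parts of the rotated displacement. Then
  \<open>\<rho> = 2 p + p\<^sup>2 + q\<^sup>2\<close>, and the center variable \<open>z\<close>, which equals \<open>q\<close> up to stable
  variables, satisfies \<open>z' = - (a / 2) (1 - P) (q \<rho>)\<close> (\<open>field_rot\<close>). If the stable variables are of
  order \<open>|z|\<^sup>2\<close>, then \<open>|z'| \<le> C |z|\<^sup>3\<close>, and integrating this gives the rate \<open>1 / sqrt t\<close>.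

  The quadratic bound on the stable variables needs no regularity of the center manifold beyond
  class \<open>C\<^sup>1\<close>. Since the manifold is a graph with small slope, the stable displacements are at
  most a constant times \<open>|z|\<close> (\<open>rotz_lower\<close>). Hence \<open>z\<close> decays at most at a slow exponential rate and the
  stable variables are driven by forces of order \<open>|z|\<^sup>2\<close>. A strict quadratic Lyapunov function \<open>L\<close> of the
  linear stable equations (\<open>lyapunov_derivative\<close>) therefore stays below a multiple of
  \<open>|z|\<^sup>4\<close> for all later times (\<open>slow_decay\<close>, \<open>slow_center_decay\<close>).\<close>

section \<open>A comparison principle\<close>

lemma mono_from_deriv:
  fixes f :: "real \<Rightarrow> real"
  assumes d: "\<And>t. t \<ge> t1 \<Longrightarrow> (f has_real_derivative f' t) (at t within {t1..})"
    and nn: "\<And>t. t \<ge> t1 \<Longrightarrow> f' t \<ge> 0" and t: "t \<ge> t1"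
  shows "f t1 \<le> f t"
proof (rule DERIV_nonneg_imp_increasing_open[OF t])
  fix s assume s: "t1 < s" "s < t"
  have "at s within {t1..} = at s"
    by (rule at_within_interior) (use s in \<open>simp add: interior_real_atLeast\<close>)
  then show "\<exists>y. (f has_real_derivative y) (at s) \<and> 0 \<le> y"
    using d[of s] nn[of s] s by auto
next
  have "continuous_on {t1..} f"
    using d by (intro DERIV_continuous_on) auto
  then show "continuous_on {t1..t} f" by (rule continuous_on_subset) auto
qed

text \<open>\<open>D\<close> is a squared center amplitude and \<open>L\<close> a Lyapunov function of the stable variables. Since
  \<open>D\<close> decays at a rate below that of \<open>L\<close>, \<open>L\<close> becomes enslaved to \<open>D\<^sup>2\<close>: the quantity
  \<open>L - B * D\<^sup>2\<close> never becomes positive once \<open>B\<close> is so large that it is not positive initially. Then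
  \<open>D' \<ge> - const * D\<^sup>2\<close>, so \<open>1 / D\<close> grows at most linearly.\<close>

lemma slow_decay:
  fixes L D L' D' :: "real \<Rightarrow> real"
  assumes dL: "\<And>t. t \<ge> t1 \<Longrightarrow> (L has_real_derivative L' t) (at t within {t1..})"
    and dD: "\<And>t. t \<ge> t1 \<Longrightarrow> (D has_real_derivative D' t) (at t within {t1..})"
    and \<mu>: "\<mu> > 0" and C: "C \<ge> 0" and k: "k \<ge> 0"
    and D0: "D t1 > 0"
    and nonneg: "\<And>t. t \<ge> t1 \<Longrightarrow> L t \<ge> 0 \<and> D t \<ge> 0"
    and L': "\<And>t. t \<ge> t1 \<Longrightarrow> L' t \<le> - \<mu> * L t + C * (D t)\<^sup>2"
    and D'1: "\<And>t. t \<ge> t1 \<Longrightarrow> D' t \<ge> - (\<mu> / 4) * D t"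
    and D'2: "\<And>t. t \<ge> t1 \<Longrightarrow> D' t \<ge> - k * (sqrt (L t) + D t) * D t"
  shows "\<exists>c>0. \<forall>\<^sub>F t in at_top. D t \<ge> c / t"
proof -
  have Dpos: "D t > 0" if t: "t \<ge> t1" for t
  proof -
    have "exp ((\<mu>/4) * t1) * D t1 \<le> exp ((\<mu>/4) * t) * D t"
    proof (rule mono_from_deriv[where f = "\<lambda>t. exp ((\<mu>/4) * t) * D t"])
      fix s assume s: "s \<ge> t1"
      show "((\<lambda>t. exp ((\<mu>/4) * t) * D t) has_real_derivative
              exp ((\<mu>/4) * s) * ((\<mu>/4) * D s + D' s)) (at s within {t1..})"
        by (auto intro!: derivative_eq_intros dD s simp: algebra_simps)
      show "exp ((\<mu>/4) * s) * ((\<mu>/4) * D s + D' s) \<ge> 0"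
        using D'1[OF s] by simp
    qed (rule t)
    moreover have "exp ((\<mu>/4) * t1) * D t1 > 0" using D0 by simp
    ultimately have "exp ((\<mu>/4) * t) * D t > 0" by linarith
    then show ?thesis by (simp add: zero_less_mult_iff)
  qed
  define B where "B = L t1 / (D t1)\<^sup>2 + 2 * C / \<mu>"
  have B0: "B \<ge> 0" unfolding B_def using nonneg[of t1] C \<mu> by simp
  have BC: "C \<le> B * \<mu> / 2"
    unfolding B_def using nonneg[of t1] \<mu> D0 by (simp add: field_simps)
  have BL: "L t1 \<le> B * (D t1)\<^sup>2"
    unfolding B_def using C \<mu> D0 by (simp add: field_simps)
  have LB: "L t \<le> B * (D t)\<^sup>2" if t: "t \<ge> t1" for t
  proof -
    have "exp (\<mu> * t1) * (B * (D t1)\<^sup>2 - L t1) \<le> exp (\<mu> * t) * (B * (D t)\<^sup>2 - L t)"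
    proof (rule mono_from_deriv[where f = "\<lambda>t. exp (\<mu> * t) * (B * (D t)\<^sup>2 - L t)"])
      fix s assume s: "s \<ge> t1"
      show "((\<lambda>t. exp (\<mu> * t) * (B * (D t)\<^sup>2 - L t)) has_real_derivative
              exp (\<mu> * s) * (\<mu> * (B * (D s)\<^sup>2 - L s) + (2 * B * D s * D' s - L' s))) (at s within {t1..})"
        by (auto intro!: derivative_eq_intros dD dL s simp: algebra_simps)
      have "D s * D' s \<ge> D s * (- (\<mu> / 4) * D s)"
        using nonneg[OF s] mult_left_mono[OF D'1[OF s]] by blast
      then have "2 * B * (D s * D' s) \<ge> 2 * B * (D s * (- (\<mu> / 4) * D s))"
        by (rule mult_left_mono) (use B0 in simp)
      then have 1: "2 * B * D s * D' s \<ge> - (B * \<mu> / 2) * (D s)\<^sup>2"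
        by (simp add: power2_eq_square algebra_simps)
      have 2: "C * (D s)\<^sup>2 \<le> (B * \<mu> / 2) * (D s)\<^sup>2"
        using BC by (intro mult_right_mono) auto
      have "\<mu> * (B * (D s)\<^sup>2 - L s) + (2 * B * D s * D' s - L' s) \<ge> 0"
        using 1 2 L'[OF s] by (simp add: algebra_simps)
      then show "exp (\<mu> * s) * (\<mu> * (B * (D s)\<^sup>2 - L s) + (2 * B * D s * D' s - L' s)) \<ge> 0"
        by simp
    qed (rule t)
    moreover have "exp (\<mu> * t1) * (B * (D t1)\<^sup>2 - L t1) \<ge> 0" using BL by simp
    ultimately have "exp (\<mu> * t) * (B * (D t)\<^sup>2 - L t) \<ge> 0" by linarith
    then show ?thesis by (simp add: zero_le_mult_iff)
  qed
  define k2 where "k2 = k * (sqrt B + 1)"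
  have k2: "k2 \<ge> 0" unfolding k2_def using k B0 by simp
  have D'3: "D' t \<ge> - k2 * (D t)\<^sup>2" if t: "t \<ge> t1" for t
  proof -
    have "sqrt (L t) \<le> sqrt (B * (D t)\<^sup>2)" using LB[OF t] by simp
    also have "\<dots> = sqrt B * D t" using Dpos[OF t] by (simp add: real_sqrt_mult)
    finally have "k * (sqrt (L t) + D t) * D t \<le> k * (sqrt B * D t + D t) * D t"
      using k Dpos[OF t] by (intro mult_right_mono mult_left_mono) auto
    then show ?thesis using D'2[OF t] by (simp add: k2_def power2_eq_square algebra_simps)
  qed
  have inv: "1 / D t \<le> 1 / D t1 + k2 * (t - t1)" if t: "t \<ge> t1" for t
  proof -
    have "k2 * t1 - 1 / D t1 \<le> k2 * t - 1 / D t"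
    proof (rule mono_from_deriv[where f = "\<lambda>t. k2 * t - 1 / D t"])
      fix s assume s: "s \<ge> t1"
      show "((\<lambda>t. k2 * t - 1 / D t) has_real_derivative k2 + D' s / (D s)\<^sup>2) (at s within {t1..})"
        using Dpos[OF s]
        by (auto intro!: derivative_eq_intros dD s simp: power2_eq_square)
      show "k2 + D' s / (D s)\<^sup>2 \<ge> 0"
        using D'3[OF s] Dpos[OF s] by (simp add: field_simps)
    qed (rule t)
    then show ?thesis by (simp add: algebra_simps)
  qed
  define c where "c = 1 / (1 / D t1 + k2 * (1 + \<bar>t1\<bar>))"
  have den: "1 / D t1 + k2 * (1 + \<bar>t1\<bar>) > 0"
    using D0 k2 by (intro add_pos_nonneg) auto
  have "c > 0" unfolding c_def using den by simp
  moreover have "\<forall>\<^sub>F t in at_top. D t \<ge> c / t"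
  proof (rule eventually_at_top_linorderI[of "max 1 t1"])
    fix t assume "max 1 t1 \<le> t"
    then have t: "t \<ge> 1" "t \<ge> t1" by auto
    have "t - t1 \<le> (1 + \<bar>t1\<bar>) * t"
    proof -
      have "\<bar>t1\<bar> * 1 \<le> \<bar>t1\<bar> * t" using t by (intro mult_left_mono) auto
      then show ?thesis by (simp add: algebra_simps)
    qed
    then have "k2 * (t - t1) \<le> k2 * ((1 + \<bar>t1\<bar>) * t)" using k2 by (rule mult_left_mono)
    moreover have "1 / D t1 * 1 \<le> 1 / D t1 * t" using t D0 by (intro mult_left_mono) auto
    ultimately have "1 / D t \<le> (1 / D t1 + k2 * (1 + \<bar>t1\<bar>)) * t"
      using inv[OF t(2)] by (simp add: algebra_simps)
    also have "\<dots> = t / c" unfolding c_def using den by simp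
    finally show "c / t \<le> D t"
      using Dpos[OF t(2)] \<open>c > 0\<close> t by (simp add: field_simps)
  qed
  ultimately show ?thesis by blast
qed

section \<open>Decay of a center variable coupled to stable variables\<close>

text \<open>The stable part of the linearized equations is \<open>p' = - 2 a p - \<eta>\<close>, \<open>r' = \<eta> - P \<eta>\<close>,
  \<open>\<eta>' = 2 (p - r) - P p\<close> with \<open>P r = 0\<close>. The energy \<open>p\<bullet>p + r\<bullet>r + (\<eta>\<bullet>\<eta> + P \<eta>\<bullet>\<eta>) / 2\<close> dissipates only
  through \<open>p\<close>; the cross terms with weights \<open>2 \<epsilon>\<close> and \<open>\<epsilon>\<close> make the decay strict in \<open>\<eta>\<close> and \<open>r\<close>.\<close>

lemma lyapunov_bounds:
  fixes p r \<eta> P\<eta> :: "'a::real_inner"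
  assumes \<epsilon>: "0 \<le> \<epsilon>" "\<epsilon> \<le> 1/4" and P: "0 \<le> P\<eta> \<bullet> \<eta>" "P\<eta> \<bullet> \<eta> \<le> \<eta> \<bullet> \<eta>"
  defines "L \<equiv> p \<bullet> p + r \<bullet> r + (\<eta> \<bullet> \<eta> + P\<eta> \<bullet> \<eta>) / 2 + 2 * \<epsilon> * (p \<bullet> \<eta>) + \<epsilon> * (r \<bullet> \<eta>)"
  defines "S \<equiv> p \<bullet> p + r \<bullet> r + \<eta> \<bullet> \<eta>"
  shows "S / 8 \<le> L" and "L \<le> 2 * S"
proof -
  have 1: "\<bar>2 * \<epsilon> * (p \<bullet> \<eta>)\<bar> \<le> (p \<bullet> p + \<eta> \<bullet> \<eta>) / 4"
  proof -
    have "2 * \<bar>p \<bullet> \<eta>\<bar> \<le> p \<bullet> p + \<eta> \<bullet> \<eta>"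
      using inner_ge_zero[of "p - \<eta>"] inner_ge_zero[of "p + \<eta>"]
      by (simp add: inner_simps inner_commute)
    then have "\<epsilon> * (2 * \<bar>p \<bullet> \<eta>\<bar>) \<le> 1/4 * (p \<bullet> p + \<eta> \<bullet> \<eta>)"
      using \<epsilon> by (intro mult_mono) auto
    then show ?thesis using \<epsilon> by (simp add: abs_mult)
  qed
  have 2: "\<bar>\<epsilon> * (r \<bullet> \<eta>)\<bar> \<le> (r \<bullet> r + \<eta> \<bullet> \<eta>) / 8"
  proof -
    have "2 * \<bar>r \<bullet> \<eta>\<bar> \<le> r \<bullet> r + \<eta> \<bullet> \<eta>"
      using inner_ge_zero[of "r - \<eta>"] inner_ge_zero[of "r + \<eta>"]
      by (simp add: inner_simps inner_commute)
    then have "\<epsilon> * (2 * \<bar>r \<bullet> \<eta>\<bar>) \<le> 1/4 * (r \<bullet> r + \<eta> \<bullet> \<eta>)"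
      using \<epsilon> by (intro mult_mono) auto
    then show ?thesis using \<epsilon> by (simp add: abs_mult)
  qed
  note facts = abs_le_D1[OF 1] abs_le_D2[OF 1] abs_le_D1[OF 2] abs_le_D2[OF 2] P inner_ge_zero[of p] inner_ge_zero[of r] inner_ge_zero[of \<eta>]
  have "(A + R + H) / 8 \<le> A + R + (H + E) / 2 + u + w"
    if "- u \<le> (A + H) / 4" "- w \<le> (R + H) / 8" "0 \<le> E" "0 \<le> A" "0 \<le> R" for A R H E u w :: real
    using that by argo
  from this[OF facts(2) facts(4) facts(5) facts(7) facts(8)]
  show "S / 8 \<le> L" unfolding L_def S_def .
  have "A + R + (H + E) / 2 + u + w \<le> 2 * (A + R + H)"
    if "u \<le> (A + H) / 4" "w \<le> (R + H) / 8" "E \<le> H" "0 \<le> A" "0 \<le> R" "0 \<le> H" for A R H E u w :: real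
    using that by argo
  from this[OF facts(1) facts(3) facts(6-9)]
  show "L \<le> 2 * S" unfolding L_def S_def .
qed

lemma inner_le_young:
  fixes x y :: "'a::real_inner"
  assumes "k > 0"
  shows "\<bar>x \<bullet> y\<bar> \<le> k * (x \<bullet> x) / 2 + (y \<bullet> y) / (2 * k)"
proof -
  have "0 \<le> (k *\<^sub>R x - y) \<bullet> (k *\<^sub>R x - y)" "0 \<le> (k *\<^sub>R x + y) \<bullet> (k *\<^sub>R x + y)"
    by (rule inner_ge_zero)+
  then have "2 * k * \<bar>x \<bullet> y\<bar> \<le> k\<^sup>2 * (x \<bullet> x) + y \<bullet> y"
    using assms by (simp add: inner_simps inner_commute power2_eq_square abs_if algebra_simps)
  then show ?thesis using assms by (simp add: field_simps power2_eq_square)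
qed

text \<open>\<open>f\<close> and \<open>g\<close> are the nonlinear remainders. The left-hand side of the inequality is the derivative
  of the function of the preceding bounds along the perturbed stable equations.\<close>

lemma lyapunov_derivative:
  fixes P :: "'a::real_inner \<Rightarrow> 'a" and p r \<eta> f g :: 'a
  assumes P: "linear P" and idem: "\<And>u. P (P u) = P u" and sa: "\<And>u v. P u \<bullet> v = u \<bullet> P v"
    and a: "a > 0" and Pr: "P r = 0"
    and \<epsilon>: "\<epsilon> = a / (2 + 2 * a\<^sup>2)"
    and G: "norm f \<le> G" "norm g \<le> G"
  defines "p' \<equiv> - (2 * a) *\<^sub>R p - \<eta> - a *\<^sub>R f"
    and "\<eta>' \<equiv> 2 *\<^sub>R (p - r) - P p - a *\<^sub>R g"
    and "r' \<equiv> \<eta> - P \<eta>"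
  shows "2 * (p \<bullet> p') + 2 * (r \<bullet> r') + \<eta> \<bullet> \<eta>' + P \<eta> \<bullet> \<eta>'
           + 2 * \<epsilon> * (p' \<bullet> \<eta> + p \<bullet> \<eta>') + \<epsilon> * (r' \<bullet> \<eta> + r \<bullet> \<eta>')
         \<le> - (\<epsilon> / 4) * (p \<bullet> p + r \<bullet> r + \<eta> \<bullet> \<eta>) + (36 * a\<^sup>2 / \<epsilon>) * G\<^sup>2"
proof -
  define s where "s = sqrt (p \<bullet> p + r \<bullet> r + \<eta> \<bullet> \<eta>)"
  have nn: "0 \<le> p \<bullet> p" "0 \<le> r \<bullet> r" "0 \<le> \<eta> \<bullet> \<eta>" by simp_all
  have s2: "s\<^sup>2 = p \<bullet> p + r \<bullet> r + \<eta> \<bullet> \<eta>" unfolding s_def using nn by simp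
  have s0: "0 \<le> s" unfolding s_def using nn by simp
  have sn: "norm p \<le> s" "norm r \<le> s" "norm \<eta> \<le> s"
    unfolding s_def norm_eq_sqrt_inner using nn by (auto intro!: real_sqrt_le_mono)
  have G0: "0 \<le> G" using G(1) norm_ge_zero order_trans by blast
  have \<epsilon>0: "0 < \<epsilon>" unfolding \<epsilon> using a by (simp add: add_pos_nonneg)
  have a1: "0 < 2 + 2 * a\<^sup>2" by (simp add: add_pos_nonneg)
  have \<epsilon>4: "\<epsilon> \<le> 1/4"
  proof -
    have "0 \<le> (a - 1)\<^sup>2" by simp
    then show ?thesis unfolding \<epsilon> using a1 by (simp add: field_simps power2_eq_square)
  qed
  have \<epsilon>a: "(11/2 + 8 * a\<^sup>2) * \<epsilon> \<le> 4 * a"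
  proof -
    have "(11/2 + 8 * a\<^sup>2) * a \<le> (8 + 8 * a\<^sup>2) * a" using a by (intro mult_right_mono) auto
    then show ?thesis unfolding \<epsilon> using a1 by (simp add: field_simps power2_eq_square)
  qed
  \<comment> \<open>P annihilates r, so every term pairing r with a vector in the range of P vanishes\<close>
  have rP: "r \<bullet> P u = 0" for u using sa[of r u] Pr by simp
  have PP: "P u \<bullet> P v = P u \<bullet> v" for u v using sa[of "P u" v] idem by simp
  have PPn: "0 \<le> P u \<bullet> u" for u
    using inner_ge_zero[of "P u"] PP[of u u] by simp
  have Pnorm: "norm (P u) \<le> norm u" for u
  proof -
    have "norm (P u) * norm (P u) = P u \<bullet> u"
      using PP[of u u] by (simp add: power2_norm_eq_inner[symmetric] power2_eq_square)
    also have "\<dots> \<le> norm (P u) * norm u" by (rule norm_cauchy_schwarz)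
    finally show ?thesis by (cases "norm (P u) = 0") auto
  qed
  define Fo where "Fo = 2 * (p \<bullet> f) + \<eta> \<bullet> g + P \<eta> \<bullet> g + 2 * \<epsilon> * (f \<bullet> \<eta>) + 2 * \<epsilon> * (p \<bullet> g) + \<epsilon> * (r \<bullet> g)"
  have Rp: "r \<bullet> P p = 0" "r \<bullet> P \<eta> = 0" "P p \<bullet> r = 0" "P \<eta> \<bullet> r = 0"
    using rP by (simp_all add: inner_commute)
  have PE: "P \<eta> \<bullet> P p = P \<eta> \<bullet> p" "\<eta> \<bullet> P p = P \<eta> \<bullet> p" "P p \<bullet> \<eta> = P \<eta> \<bullet> p"
    using PP sa by (simp_all add: inner_commute)
  have eq: "2 * (p \<bullet> p') + 2 * (r \<bullet> r') + \<eta> \<bullet> \<eta>' + P \<eta> \<bullet> \<eta>'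
           + 2 * \<epsilon> * (p' \<bullet> \<eta> + p \<bullet> \<eta>') + \<epsilon> * (r' \<bullet> \<eta> + r \<bullet> \<eta>')
     = - (4 * a) * (p \<bullet> p) + 4 * \<epsilon> * (p \<bullet> p) - 4 * \<epsilon> * a * (p \<bullet> \<eta>) - \<epsilon> * (\<eta> \<bullet> \<eta>) - 2 * \<epsilon> * (p \<bullet> r)
       - 2 * \<epsilon> * (P p \<bullet> p) - \<epsilon> * (P \<eta> \<bullet> \<eta>) - 2 * \<epsilon> * (r \<bullet> r) - a * Fo"
    unfolding p'_def \<eta>'_def r'_def Fo_def
    by (simp add: inner_simps Rp PE inner_commute[of \<eta> p] inner_commute[of r p] inner_commute[of \<eta> r]
        inner_commute[of p "P p"] inner_commute[of f] algebra_simps)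
  have c1: "\<bar>4 * \<epsilon> * a * (p \<bullet> \<eta>)\<bar> \<le> \<epsilon> * (8 * a\<^sup>2 * (p \<bullet> p)) + \<epsilon> * ((\<eta> \<bullet> \<eta>) / 2)"
  proof -
    have "\<bar>p \<bullet> \<eta>\<bar> \<le> 4 * a * (p \<bullet> p) / 2 + (\<eta> \<bullet> \<eta>) / (2 * (4 * a))"
      by (rule inner_le_young) (use a in simp)
    then have "4 * \<epsilon> * a * \<bar>p \<bullet> \<eta>\<bar> \<le> 4 * \<epsilon> * a * (4 * a * (p \<bullet> p) / 2 + (\<eta> \<bullet> \<eta>) / (2 * (4 * a)))"
      using a \<epsilon>0 by (intro mult_left_mono) auto
    also have "\<dots> = \<epsilon> * (8 * a\<^sup>2 * (p \<bullet> p)) + \<epsilon> * ((\<eta> \<bullet> \<eta>) / 2)"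
      using a by (simp add: field_simps power2_eq_square)
    finally show ?thesis using a \<epsilon>0 by (simp add: abs_mult)
  qed
  have c2: "\<bar>2 * \<epsilon> * (p \<bullet> r)\<bar> \<le> \<epsilon> * (p \<bullet> p) + \<epsilon> * (r \<bullet> r)"
  proof -
    have "2 * \<epsilon> * \<bar>p \<bullet> r\<bar> \<le> 2 * \<epsilon> * (1 * (p \<bullet> p) / 2 + (r \<bullet> r) / (2 * 1))"
      using \<epsilon>0 by (intro mult_left_mono inner_le_young) auto
    then show ?thesis using \<epsilon>0 by (simp add: abs_mult algebra_simps)
  qed
  have c3: "0 \<le> \<epsilon> * (P p \<bullet> p)" "0 \<le> \<epsilon> * (P \<eta> \<bullet> \<eta>)" using \<epsilon>0 PPn by simp_all
  have c4: "(11/2 + 8 * a\<^sup>2) * \<epsilon> * (p \<bullet> p) \<le> 4 * a * (p \<bullet> p)"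
    using \<epsilon>a by (intro mult_right_mono) auto
  have ip: "\<bar>u \<bullet> w\<bar> \<le> s * G" if "norm u \<le> s" "norm w \<le> G" for u w :: 'a
  proof -
    have "\<bar>u \<bullet> w\<bar> \<le> norm u * norm w" by (rule Cauchy_Schwarz_ineq2)
    also have "\<dots> \<le> s * G" using that s0 by (intro mult_mono) auto
    finally show ?thesis .
  qed
  have sG: "0 \<le> s * G" using s0 G0 by simp
  have e1: "\<bar>\<epsilon> * x\<bar> \<le> s * G / 4" if "\<bar>x\<bar> \<le> s * G" for x
    using mult_mono[OF \<epsilon>4 that] \<epsilon>0 by (simp add: abs_mult)
  have Fo: "\<bar>Fo\<bar> \<le> 6 * (s * G)"
    using ip[OF sn(1) G(1)] ip[OF sn(3) G(2)] ip[OF order_trans[OF Pnorm sn(3)] G(2)]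
      e1[OF ip[OF sn(3) G(1)]] e1[OF ip[OF sn(1) G(2)]] e1[OF ip[OF sn(2) G(2)]] sG
    unfolding Fo_def by (simp add: inner_commute[of f \<eta>])
  have aFo: "- (a * Fo) \<le> \<epsilon> / 4 * s\<^sup>2 + (36 * a\<^sup>2 / \<epsilon>) * G\<^sup>2"
  proof -
    have "- (a * Fo) \<le> a * (6 * (s * G))"
      using mult_left_mono[of "- Fo" "6 * (s * G)" a] Fo a by (simp add: abs_le_iff)
    also have "\<dots> \<le> \<epsilon> / 4 * s\<^sup>2 + (36 * a\<^sup>2 / \<epsilon>) * G\<^sup>2"
    proof -
      have "0 \<le> (\<epsilon> * s / 2 - 6 * a * G)\<^sup>2" by simp
      then have "\<epsilon> * (a * (6 * (s * G))) \<le> \<epsilon> * (\<epsilon> / 4 * s\<^sup>2) + 36 * a\<^sup>2 * G\<^sup>2"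
        by (simp add: power2_eq_square algebra_simps)
      also have "\<dots> = \<epsilon> * (\<epsilon> / 4 * s\<^sup>2 + (36 * a\<^sup>2 / \<epsilon>) * G\<^sup>2)"
        using \<epsilon>0 by (simp add: field_simps)
      finally show ?thesis using \<epsilon>0 by simp
    qed
    finally show ?thesis .
  qed
  have "- (4 * a) * (p \<bullet> p) + 4 * \<epsilon> * (p \<bullet> p) - 4 * \<epsilon> * a * (p \<bullet> \<eta>) - \<epsilon> * (\<eta> \<bullet> \<eta>) - 2 * \<epsilon> * (p \<bullet> r)
       - 2 * \<epsilon> * (P p \<bullet> p) - \<epsilon> * (P \<eta> \<bullet> \<eta>) - 2 * \<epsilon> * (r \<bullet> r) \<le> - (\<epsilon> / 2) * s\<^sup>2"
    using c1 c2 c3 c4 mult_nonneg_nonneg[OF less_imp_le[OF \<epsilon>0] nn(2)]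
    unfolding s2 by (simp add: algebra_simps abs_le_iff)
  then show ?thesis using aFo unfolding eq s2[symmetric] by linarith
qed

text \<open>Here \<open>z\<close> is the center variable; its velocity consists of the nonlinear term \<open>g\<close> alone, which is cubic
  in \<open>z\<close> as soon as \<open>p\<close> is quadratic in \<open>z\<close>.\<close>

lemma slow_center_decay:
  fixes P :: "'a::real_inner \<Rightarrow> 'a" and p r \<eta> z f g :: "real \<Rightarrow> 'a"
  assumes P: "bounded_linear P" and idem: "\<And>u. P (P u) = P u" and sa: "\<And>u v. P u \<bullet> v = u \<bullet> P v"
    and a: "a > 0" and C: "C \<ge> 0"
    and dp: "\<And>t. t \<ge> t1 \<Longrightarrow> (p has_vector_derivative (- (2 * a) *\<^sub>R p t - \<eta> t - a *\<^sub>R f t)) (at t within {t1..})"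
    and d\<eta>: "\<And>t. t \<ge> t1 \<Longrightarrow> (\<eta> has_vector_derivative (2 *\<^sub>R (p t - r t) - P (p t) - a *\<^sub>R g t)) (at t within {t1..})"
    and dr: "\<And>t. t \<ge> t1 \<Longrightarrow> (r has_vector_derivative (\<eta> t - P (\<eta> t))) (at t within {t1..})"
    and dz: "\<And>t. t \<ge> t1 \<Longrightarrow> (z has_vector_derivative (- (a / 2) *\<^sub>R (g t - P (g t)))) (at t within {t1..})"
    and Pr: "\<And>t. t \<ge> t1 \<Longrightarrow> P (r t) = 0"
    and f: "\<And>t. t \<ge> t1 \<Longrightarrow> norm (f t) \<le> C * (norm (z t))\<^sup>2"
    and g: "\<And>t. t \<ge> t1 \<Longrightarrow> norm (g t) \<le> C * (norm (z t))\<^sup>2"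
    and g': "\<And>t. t \<ge> t1 \<Longrightarrow> norm (g t) \<le> C * norm (z t) * (norm (p t) + (norm (z t))\<^sup>2)"
    and small: "\<And>t. t \<ge> t1 \<Longrightarrow> C * (norm (p t) + (norm (z t))\<^sup>2) \<le> 1 / (128 * (1 + a\<^sup>2))"
    and z1: "z t1 \<noteq> 0"
  shows "\<exists>c>0. \<forall>\<^sub>F t in at_top. norm (z t) \<ge> c / sqrt t"
proof -
  interpret P: bounded_linear P by (rule P)
  define \<epsilon> where "\<epsilon> = a / (2 + 2 * a\<^sup>2)"
  have a1: "0 < 2 + 2 * a\<^sup>2" by (simp add: add_pos_nonneg)
  have \<epsilon>0: "0 < \<epsilon>" unfolding \<epsilon>_def using a a1 by simp
  have \<epsilon>4: "\<epsilon> \<le> 1/4"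
  proof -
    have "0 \<le> (a - 1)\<^sup>2" by simp
    then show ?thesis unfolding \<epsilon>_def using a1 by (simp add: field_simps power2_eq_square)
  qed
  have PP: "P u \<bullet> P v = P u \<bullet> v" for u v using sa[of "P u" v] idem by simp
  have P0: "0 \<le> P u \<bullet> u" for u
    using inner_ge_zero[of "P u"] PP[of u u] by simp
  have P1: "P u \<bullet> u \<le> u \<bullet> u" for u
    using inner_ge_zero[of "u - P u"] PP[of u u] by (simp add: inner_simps inner_commute)
  define L where "L = (\<lambda>t. p t \<bullet> p t + r t \<bullet> r t + (\<eta> t \<bullet> \<eta> t + P (\<eta> t) \<bullet> \<eta> t) / 2
      + 2 * \<epsilon> * (p t \<bullet> \<eta> t) + \<epsilon> * (r t \<bullet> \<eta> t))"
  define S where "S = (\<lambda>t. p t \<bullet> p t + r t \<bullet> r t + \<eta> t \<bullet> \<eta> t)"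
  define D where "D = (\<lambda>t. z t \<bullet> z t)"
  have Dz: "D t = (norm (z t))\<^sup>2" for t by (simp add: D_def power2_norm_eq_inner)
  have LS: "S t / 8 \<le> L t" "L t \<le> 2 * S t" for t
    unfolding L_def S_def using \<epsilon>0
    by (rule lyapunov_bounds[OF less_imp_le \<epsilon>4 P0 P1])+
  have S0: "0 \<le> S t" for t unfolding S_def by simp
  define p' where "p' = (\<lambda>t. - (2 * a) *\<^sub>R p t - \<eta> t - a *\<^sub>R f t)"
  define \<eta>' where "\<eta>' = (\<lambda>t. 2 *\<^sub>R (p t - r t) - P (p t) - a *\<^sub>R g t)"
  define r' where "r' = (\<lambda>t. \<eta> t - P (\<eta> t))"
  define L' where "L' = (\<lambda>t. 2 * (p t \<bullet> p' t) + 2 * (r t \<bullet> r' t) + \<eta> t \<bullet> \<eta>' t + P (\<eta> t) \<bullet> \<eta>' t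
           + 2 * \<epsilon> * (p' t \<bullet> \<eta> t + p t \<bullet> \<eta>' t) + \<epsilon> * (r' t \<bullet> \<eta> t + r t \<bullet> \<eta>' t))"
  define D' where "D' = (\<lambda>t. - a * (z t \<bullet> (g t - P (g t))))"
  have dinner: "((\<lambda>t. u t \<bullet> w t) has_real_derivative (u' \<bullet> w t + u t \<bullet> w')) (at t within T)"
    if "(u has_vector_derivative u') (at t within T)" "(w has_vector_derivative w') (at t within T)"
    for u w :: "real \<Rightarrow> 'a" and u' w' t T
    using bounded_bilinear.has_vector_derivative[OF bounded_bilinear_inner that]
    by (simp add: has_real_derivative_iff_has_vector_derivative add.commute)
  have dL: "(L has_real_derivative L' t) (at t within {t1..})" if t: "t \<ge> t1" for t
  proof -
    have 1: "(p has_vector_derivative p' t) (at t within {t1..})"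
      "(\<eta> has_vector_derivative \<eta>' t) (at t within {t1..})"
      "(r has_vector_derivative r' t) (at t within {t1..})"
      using dp[OF t] d\<eta>[OF t] dr[OF t] by (simp_all add: p'_def \<eta>'_def r'_def)
    have 2: "((\<lambda>t. P (\<eta> t)) has_vector_derivative P (\<eta>' t)) (at t within {t1..})"
      by (rule P.has_vector_derivative[OF 1(2)])
    have "(L has_real_derivative
        (p' t \<bullet> p t + p t \<bullet> p' t) + (r' t \<bullet> r t + r t \<bullet> r' t)
        + ((\<eta>' t \<bullet> \<eta> t + \<eta> t \<bullet> \<eta>' t) + (P (\<eta>' t) \<bullet> \<eta> t + P (\<eta> t) \<bullet> \<eta>' t)) / 2
        + 2 * \<epsilon> * (p' t \<bullet> \<eta> t + p t \<bullet> \<eta>' t) + \<epsilon> * (r' t \<bullet> \<eta> t + r t \<bullet> \<eta>' t)) (at t within {t1..})"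
      unfolding L_def
      by (intro DERIV_add DERIV_cmult DERIV_cdivide dinner[OF 1(1) 1(1)] dinner[OF 1(3) 1(3)]
          dinner[OF 1(2) 1(2)] dinner[OF 2 1(2)] dinner[OF 1(1) 1(2)] dinner[OF 1(3) 1(2)])
    moreover have "P (\<eta>' t) \<bullet> \<eta> t = P (\<eta> t) \<bullet> \<eta>' t"
      using sa[of "\<eta>' t" "\<eta> t"] by (simp add: inner_commute)
    ultimately show ?thesis
      by (elim DERIV_cong) (simp add: L'_def inner_commute[of "p' t" "p t"] inner_commute[of "r' t" "r t"]
          inner_commute[of "\<eta>' t" "\<eta> t"])
  qed
  have dD: "(D has_real_derivative D' t) (at t within {t1..})" if t: "t \<ge> t1" for t
    using dinner[OF dz[OF t] dz[OF t]]
    unfolding D_def D'_def by (elim DERIV_cong) (simp add: inner_commute[of "g t - P (g t)" "z t"])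
  define C1 where "C1 = (36 * a\<^sup>2 / \<epsilon>) * C\<^sup>2"
  have D'bound: "D' t \<ge> - (2 * a) * (C * (norm (p t) + D t)) * D t" if t: "t \<ge> t1" for t
  proof -
    have Pnorm: "norm (g t - P (g t)) \<le> norm (g t)"
    proof -
      have "(norm (g t - P (g t)))\<^sup>2 = g t \<bullet> g t - P (g t) \<bullet> g t"
        using PP[of "g t" "g t"] by (simp add: power2_norm_eq_inner inner_simps inner_commute)
      also have "\<dots> \<le> (norm (g t))\<^sup>2" using P0[of "g t"] by (simp add: power2_norm_eq_inner)
      finally show ?thesis by (rule power2_le_imp_le) simp
    qed
    have "z t \<bullet> (g t - P (g t)) \<le> norm (z t) * norm (g t - P (g t))" by (rule norm_cauchy_schwarz)
    also have "\<dots> \<le> norm (z t) * (C * norm (z t) * (norm (p t) + (norm (z t))\<^sup>2))"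
      using g'[OF t] Pnorm by (intro mult_left_mono) auto
    also have "\<dots> = C * (norm (p t) + D t) * D t"
      unfolding Dz by (simp add: power2_eq_square algebra_simps)
    finally have "a * (z t \<bullet> (g t - P (g t))) \<le> a * (C * (norm (p t) + D t) * D t)"
      using a by (intro mult_left_mono) auto
    moreover have "0 \<le> a * (C * (norm (p t) + D t) * D t)"
      using a C by (simp add: Dz)
    ultimately show ?thesis unfolding D'_def by linarith
  qed
  have "\<exists>c>0. \<forall>\<^sub>F t in at_top. D t \<ge> c / t"
  proof (rule slow_decay[OF dL dD, where \<mu> = "\<epsilon> / 8" and C = C1 and k = "2 * a * C * 3"])
    show "0 < \<epsilon> / 8" using \<epsilon>0 by simp
    show "0 \<le> C1" unfolding C1_def using \<epsilon>0 by simp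
    show "0 \<le> 2 * a * C * 3" using a C by simp
    show "0 < D t1" unfolding D_def using z1 by simp
  next
    fix t assume t: "t \<ge> t1"
    show "0 \<le> L t \<and> 0 \<le> D t" using LS(1)[of t] S0[of t] unfolding D_def by simp
    have "L' t \<le> - (\<epsilon> / 4) * S t + (36 * a\<^sup>2 / \<epsilon>) * (C * (norm (z t))\<^sup>2)\<^sup>2"
      unfolding L'_def S_def p'_def \<eta>'_def r'_def
      by (rule lyapunov_derivative[OF P.linear idem sa a Pr[OF t] \<epsilon>_def f[OF t] g[OF t]])
    moreover have "(\<epsilon> / 8) * L t \<le> (\<epsilon> / 8) * (2 * S t)"
      using LS(2) \<epsilon>0 by (intro mult_left_mono) auto
    ultimately show "L' t \<le> - (\<epsilon> / 8) * L t + C1 * (D t)\<^sup>2"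
      unfolding C1_def Dz by (simp add: power_mult_distrib algebra_simps)
    have "a * (C * (norm (p t) + D t)) \<le> a * (1 / (128 * (1 + a\<^sup>2)))"
      using small[OF t] a unfolding Dz by (intro mult_left_mono) auto
    also have "\<dots> = \<epsilon> / 64" unfolding \<epsilon>_def using a1 by (simp add: field_simps)
    finally have "(2 * (a * (C * (norm (p t) + D t)))) * D t \<le> (\<epsilon> / 32) * D t"
      by (intro mult_right_mono) (auto simp: Dz)
    then show "D' t \<ge> - (\<epsilon> / 8 / 4) * D t"
      using D'bound[OF t] by (simp add: algebra_simps)
    have "p t \<bullet> p t \<le> S t" unfolding S_def by simp
    then have "(norm (p t))\<^sup>2 \<le> 9 * L t"
      unfolding power2_norm_eq_inner using LS(1)[of t] S0[of t] by linarith
    then have "norm (p t) \<le> sqrt (9 * L t)" by (rule real_le_rsqrt)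
    also have "\<dots> = 3 * sqrt (L t)" by (simp add: real_sqrt_mult)
    finally have "norm (p t) + D t \<le> 3 * sqrt (L t) + 3 * D t" by (rule add_mono) (simp add: Dz)
    then have "norm (p t) + D t \<le> 3 * (sqrt (L t) + D t)" by (simp only: distrib_left)
    then have "(2 * a * C) * (norm (p t) + D t) * D t \<le> (2 * a * C) * (3 * (sqrt (L t) + D t)) * D t"
      using a C by (intro mult_right_mono mult_left_mono) (auto simp: Dz)
    then show "D' t \<ge> - (2 * a * C * 3) * (sqrt (L t) + D t) * D t"
      using D'bound[OF t] by (simp add: algebra_simps)
  qed
  then obtain c where c: "c > 0" "\<forall>\<^sub>F t in at_top. D t \<ge> c / t" by blast
  have "\<forall>\<^sub>F t in at_top. norm (z t) \<ge> sqrt c / sqrt t"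
    using c(2) eventually_gt_at_top[of 0]
  proof eventually_elim
    case (elim t)
    have "sqrt (c / t) \<le> sqrt (D t)" using elim by simp
    then show ?case by (simp add: Dz real_sqrt_divide)
  qed
  then show ?thesis using c(1) by (intro exI[of _ "sqrt c"]) simp
qed

section \<open>The matrix of the reduced system\<close>

lemma sum_UNIV_Plus:
  fixes f :: "'a::finite + 'b::finite \<Rightarrow> 'c::comm_monoid_add"
  shows "(\<Sum>i\<in>UNIV. f i) = (\<Sum>j\<in>UNIV. f (Inl j)) + (\<Sum>j\<in>UNIV. f (Inr j))"
  unfolding UNIV_Plus_UNIV[symmetric] by (subst sum.Plus) simp_all

lemma Xvec_simps [simp]: "Xvec $ Inl j = 1" "Xvec $ Inr j = -1"
  by (simp_all add: Xvec_def)

lemma Xvec_inner_Xvec: "(Xvec :: real^('N::finite + 'N)) \<bullet> Xvec = real CARD('N + 'N)"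
  by (simp add: inner_vec_def sum_UNIV_Plus)

lemma Xvec_inner_one: "(Xvec :: real^('N::finite + 'N)) \<bullet> 1 = 0"
  by (simp add: inner_vec_def sum_UNIV_Plus)

lemma independent_image_coeffs:
  fixes u :: "'i \<Rightarrow> 'a::real_vector"
  assumes ind: "independent (u ` I)" and inj: "inj_on u I" and fin: "finite I"
    and z: "(\<Sum>i\<in>I. c i *\<^sub>R u i) = 0" and i: "i \<in> I"
  shows "c i = 0"
proof -
  define d where "d = (\<lambda>w. c (the_inv_into I u w))"
  have d: "d (u k) = c k" if "k \<in> I" for k
    unfolding d_def using the_inv_into_f_f[OF inj that] by simp
  have "(\<Sum>w\<in>u ` I. d w *\<^sub>R w) = (\<Sum>k\<in>I. c k *\<^sub>R u k)"
    by (subst sum.reindex[OF inj]) (simp add: d)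
  then have "d (u i) = 0"
    using independentD[OF ind, of "u ` I" d "u i"] fin i z by auto
  then show ?thesis using d[OF i] by simp
qed

text \<open>Columns of index at most N - 1 carry the upper coordinates, those of index N to 2N - 2 the
  lower ones, and the column of ones has index 2N - 1.\<close>

context
  fixes v :: "nat \<Rightarrow> real^'N::finite" and e :: "'p::finite \<Rightarrow> nat"
  assumes e: "coord_numbering TYPE('N) e" and v: "zero_sum_basis v"
begin

lemma CARD_ge_1: "CARD('N) \<ge> 1"
  using zero_less_card_finite[where 'a = 'N] by linarith

lemma e_inj: "inj e" and e_range: "range e = {1 .. 2 * CARD('N) - 1}"
  using e unfolding coord_numbering_def bij_betw_def by auto

lemma ex1_last_index: "\<exists>!p. e p = 2 * CARD('N) - 1"
proof -
  have "1 \<le> 2 * CARD('N) - 1" using CARD_ge_1 by linarith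
  then have "2 * CARD('N) - 1 \<in> range e" unfolding e_range by simp
  then show ?thesis using e_inj by (metis rangeE injD)
qed

text \<open>The index of the last column \<open>1\<close> of the matrix.\<close>

definition last_index :: 'p where "last_index = (THE p. e p = 2 * CARD('N) - 1)"

lemma e_eq_last_iff: "e p = 2 * CARD('N) - 1 \<longleftrightarrow> p = last_index"
  unfolding last_index_def using ex1_last_index theI'[OF ex1_last_index] by blast

text \<open>The indices of the coordinates \<open>Z\<^sub>U\<close> and \<open>Z\<^sub>L\<close>.\<close>

definition upper_coords :: "'p set" where
  "upper_coords = {p. e p \<le> CARD('N) - 1}"
definition lower_coords :: "'p set" where
  "lower_coords = {p. CARD('N) - 1 < e p \<and> e p \<le> 2 * CARD('N) - 2}"

lemma UNIV_split:
  "UNIV = upper_coords \<union> lower_coords \<union> {last_index}"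
  "upper_coords \<inter> lower_coords = {}" "last_index \<notin> upper_coords" "last_index \<notin> lower_coords"
proof -
  have e_le: "e p \<le> 2 * CARD('N) - 1" for p using e_range by (metis atLeastAtMost_iff rangeI)
  have "p \<in> upper_coords \<union> lower_coords \<union> {last_index}" for p
  proof -
    consider "e p \<le> CARD('N) - 1" | "CARD('N) - 1 < e p" "e p \<le> 2 * CARD('N) - 2" | "e p = 2 * CARD('N) - 1"
      using e_le[of p] by linarith
    then show ?thesis unfolding upper_coords_def lower_coords_def using e_eq_last_iff[of p] by cases auto
  qed
  then show "UNIV = upper_coords \<union> lower_coords \<union> {last_index}" by auto
  have "e last_index = 2 * CARD('N) - 1" using e_eq_last_iff by blast
  then show "last_index \<notin> upper_coords" "last_index \<notin> lower_coords" unfolding upper_coords_def lower_coords_def using CARD_ge_1 by (simp_all, linarith+)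
qed (auto simp: upper_coords_def lower_coords_def)

lemma sum_UNIV_split: "(\<Sum>p\<in>UNIV. f p) = (\<Sum>p\<in>upper_coords. f p) + (\<Sum>p\<in>lower_coords. f p) + f last_index"
  for f :: "'p \<Rightarrow> real"
  using UNIV_split(2-4) by (subst UNIV_split(1), subst sum.union_disjoint) (auto simp: sum.union_disjoint)

lemma VV_mult:
  "(VV e v *v x) $ Inl j = (\<Sum>p\<in>upper_coords. x $ p *\<^sub>R v (e p)) $ j + x $ last_index"
  "(VV e v *v x) $ Inr j = (\<Sum>p\<in>lower_coords. x $ p *\<^sub>R v (e p - (CARD('N) - 1))) $ j + x $ last_index"
proof -
  have last: "e last_index = 2 * CARD('N) - 1" using e_eq_last_iff by blast
  have nl: "\<not> 2 * CARD('N) - 1 \<le> CARD('N) - 1" "\<not> 2 * CARD('N) - 1 \<le> 2 * CARD('N) - 2"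
    using CARD_ge_1 by linarith+
  have "VV e v $ Inl j $ p = v (e p) $ j" "VV e v $ Inr j $ p = 0" if "p \<in> upper_coords" for p j
    using that by (simp_all add: upper_coords_def VV_def)
  moreover have "VV e v $ Inl j $ p = 0" "VV e v $ Inr j $ p = v (e p - (CARD('N) - 1)) $ j"
    if "p \<in> lower_coords" for p j
    using that by (simp_all add: lower_coords_def VV_def)
  moreover have "VV e v $ i $ last_index = 1" for i
    using last nl unfolding VV_def by (simp del: One_nat_def)
  ultimately show "(VV e v *v x) $ Inl j = (\<Sum>p\<in>upper_coords. x $ p *\<^sub>R v (e p)) $ j + x $ last_index"
    "(VV e v *v x) $ Inr j = (\<Sum>p\<in>lower_coords. x $ p *\<^sub>R v (e p - (CARD('N) - 1))) $ j + x $ last_index"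
    unfolding matrix_vector_mult_def
    by (simp_all add: sum_UNIV_split mult.commute)
qed

lemma column_zero_sum: "(\<Sum>j\<in>UNIV. v k $ j) = 0" if "k \<in> {1 .. CARD('N) - 1}"
proof -
  have "v k \<in> span (v ` {1 .. CARD('N) - 1})" using that by (intro span_base) auto
  then have "v k \<bullet> 1 = 0" using v unfolding zero_sum_basis_def by auto
  then show ?thesis by (simp add: inner_vec_def)
qed

lemma e_ge1: "e p \<ge> 1" using e_range by (metis atLeastAtMost_iff rangeI)

lemma sum_upper: "(\<Sum>j\<in>UNIV. (VV e v *v x) $ Inl j) = real CARD('N) * x $ last_index"
  and sum_lower: "(\<Sum>j\<in>UNIV. (VV e v *v x) $ Inr j) = real CARD('N) * x $ last_index"
proof -
  have 1: "(\<Sum>j\<in>UNIV. (\<Sum>p\<in>I. x $ p *\<^sub>R v (k p)) $ j) = 0"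
    if "\<And>p. p \<in> I \<Longrightarrow> k p \<in> {1 .. CARD('N) - 1}" for I k
  proof -
    have "(\<Sum>j\<in>UNIV. (\<Sum>p\<in>I. x $ p *\<^sub>R v (k p)) $ j) = (\<Sum>p\<in>I. x $ p * (\<Sum>j\<in>UNIV. v (k p) $ j))"
      by (simp add: sum_distrib_left, subst sum.swap, rule refl)
    also have "\<dots> = 0" using column_zero_sum[OF that] by (intro sum.neutral) simp
    finally show ?thesis .
  qed
  show "(\<Sum>j\<in>UNIV. (VV e v *v x) $ Inl j) = real CARD('N) * x $ last_index"
    unfolding VV_mult sum.distrib by (subst 1) (auto simp: upper_coords_def e_ge1 Suc_le_eq[symmetric] e_ge1[simplified])
  show "(\<Sum>j\<in>UNIV. (VV e v *v x) $ Inr j) = real CARD('N) * x $ last_index"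
    unfolding VV_mult sum.distrib by (subst 1) (auto simp: lower_coords_def)
qed

lemma VV_orth: "(VV e v *v x) \<bullet> Xvec = 0"
  by (simp add: inner_vec_def sum_UNIV_Plus sum_upper sum_lower sum_negf)

lemma VV_inj: assumes "VV e v *v x = 0" shows "x = 0"
proof -
  have last: "x $ last_index = 0"
    using sum_upper[of x] CARD_ge_1 unfolding assms by simp
  have ind: "independent (v ` {1 .. CARD('N) - 1})" "inj_on v {1 .. CARD('N) - 1}"
    using v unfolding zero_sum_basis_def by auto
  have coeffs: "x $ p = 0"
    if k: "\<And>p. p \<in> I \<Longrightarrow> k p \<in> {1 .. CARD('N) - 1}" "inj_on k I" and p: "p \<in> I"
      and z: "(\<Sum>p\<in>I. x $ p *\<^sub>R v (k p)) = 0" for I k p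
  proof (rule independent_image_coeffs[where u = "\<lambda>p. v (k p)" and I = I])
    show "independent ((\<lambda>p. v (k p)) ` I)"
      by (rule independent_mono[OF ind(1)]) (use k(1) in auto)
    show "inj_on (\<lambda>p. v (k p)) I"
      using k ind(2) unfolding inj_on_def by blast
  qed (use p z in auto)
  have "x $ p = 0" for p
  proof -
    consider "p \<in> upper_coords" | "p \<in> lower_coords" | "p = last_index" using UNIV_split(1) by blast
    then show ?thesis
    proof cases
      case 1
      have "(\<Sum>p\<in>upper_coords. x $ p *\<^sub>R v (e p)) = 0"
        using VV_mult(1)[of x] last unfolding assms by (simp add: vec_eq_iff)
      then show ?thesis
        by (intro coeffs[where I = upper_coords and k = e, OF _ _ 1])
          (use e_ge1 e_inj in \<open>auto simp: upper_coords_def inj_on_def Suc_le_eq\<close>)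
    next
      case 2
      have "(\<Sum>p\<in>lower_coords. x $ p *\<^sub>R v (e p - (CARD('N) - 1))) = 0"
        using VV_mult(2)[of x] last unfolding assms by (simp add: vec_eq_iff)
      moreover have "inj_on (\<lambda>p. e p - (CARD('N) - 1)) lower_coords"
      proof (rule inj_onI)
        fix p q assume "p \<in> lower_coords" "q \<in> lower_coords" "e p - (CARD('N) - 1) = e q - (CARD('N) - 1)"
        then have "e p = e q" unfolding lower_coords_def by auto
        then show "p = q" using e_inj by (simp add: inj_eq)
      qed
      ultimately show ?thesis
        by (intro coeffs[where I = lower_coords and k = "\<lambda>p. e p - (CARD('N) - 1)", OF _ _ 2])
          (auto simp: lower_coords_def)
    qed (use last in simp)
  qed
  then show ?thesis by (simp add: vec_eq_iff)
qed

lemma VVX_mult: "VVX B *v y = B *v (\<chi> p. y $ Some p) + y $ None *\<^sub>R Xvec"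
  for B :: "real^'p^('N + 'N)"
  unfolding VVX_def matrix_vector_mult_def
  by (simp add: vec_eq_iff UNIV_option_conv sum.reindex mult.commute)

lemma CARD_option_eq: "CARD('p option) = CARD('N + 'N)"
proof -
  have "CARD('p) = 2 * CARD('N) - 1"
    using card_image[OF e_inj] unfolding e_range by simp
  then show ?thesis using CARD_ge_1 by (simp add: card_UNIV_option)
qed

lemma VVX_inverse:
  "VVX (VV e v) ** matrix_inv (VVX (VV e v)) = mat 1" "matrix_inv (VVX (VV e v)) ** VVX (VV e v) = mat 1"
proof -
  let ?A = "VVX (VV e v)"
  have ker: "y = 0" if y: "?A *v y = 0" for y
  proof -
    have eq: "VV e v *v (\<chi> p. y $ Some p) + y $ None *\<^sub>R Xvec = 0"
      using y unfolding VVX_mult .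
    then have "(VV e v *v (\<chi> p. y $ Some p) + y $ None *\<^sub>R Xvec) \<bullet> Xvec = 0" by simp
    then have none: "y $ None = 0" by (simp add: inner_add_left VV_orth Xvec_inner_Xvec)
    then have "(\<chi> p. y $ Some p) = 0" using eq by (intro VV_inj) simp
    then have "y $ Some p = 0" for p by (simp add: vec_eq_iff)
    then show ?thesis using none by (metis vec_eq_iff zero_index not_Some_eq)
  qed
  then obtain B1 where B1: "B1 ** ?A = mat 1"
    using matrix_left_invertible_ker by blast
  have inj: "inj ((*v) ?A)" using B1 matrix_left_invertible_injective by blast
  have "dim (range ((*v) ?A)) = dim (UNIV :: (real^'p option) set)"
    by (rule dim_image_eq) (use inj in \<open>auto simp: linear_linear\<close>)
  also have "\<dots> = CARD('N + 'N)" using CARD_option_eq by (simp add: dim_UNIV)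
  finally have "dim (range ((*v) ?A)) = DIM(real^('N + 'N))" by simp
  then have "span (range ((*v) ?A)) = UNIV" using dim_eq_full by blast
  moreover have "subspace (range ((*v) ?A))"
    by (intro linear_subspace_image) auto
  ultimately have "surj ((*v) ?A)" by (metis span_eq_iff)
  then obtain B2 where B2: "?A ** B2 = mat 1"
    using matrix_right_invertible_surjective by blast
  have "B1 = B2" by (metis B1 B2 matrix_mul_assoc matrix_mul_lid matrix_mul_rid)
  then have "\<exists>A'. ?A ** A' = mat 1 \<and> A' ** ?A = mat 1" using B1 B2 by blast
  then have "?A ** matrix_inv ?A = mat 1 \<and> matrix_inv ?A ** ?A = mat 1"
    unfolding matrix_inv_def by (rule someI_ex)
  then show "?A ** matrix_inv ?A = mat 1" "matrix_inv ?A ** ?A = mat 1" by auto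
qed

lemma TT_mult: "TT B *v u = (\<chi> p. (matrix_inv (VVX B) *v u) $ Some p)"
  for B :: "real^'p^('N + 'N)"
  by (simp add: TT_def matrix_vector_mult_def)

lemma TT_VV: "TT (VV e v) *v (VV e v *v x + t *\<^sub>R Xvec) = x"
proof -
  define y :: "real^'p option" where "y = (\<chi> q. case q of Some p \<Rightarrow> x $ p | None \<Rightarrow> t)"
  have "VVX (VV e v) *v y = VV e v *v x + t *\<^sub>R Xvec"
    unfolding VVX_mult by (simp add: y_def)
  moreover have "matrix_inv (VVX (VV e v)) *v (VVX (VV e v) *v y) = y"
    by (simp add: matrix_vector_mul_assoc VVX_inverse)
  ultimately have "matrix_inv (VVX (VV e v)) *v (VV e v *v x + t *\<^sub>R Xvec) = y" by simp
  then show ?thesis unfolding TT_mult by (simp add: y_def)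
qed

lemma VV_TT: "VV e v *v (TT (VV e v) *v u) = u - ((u \<bullet> Xvec) / real CARD('N + 'N)) *\<^sub>R Xvec"
proof -
  define y where "y = matrix_inv (VVX (VV e v)) *v u"
  have "VVX (VV e v) *v y = u"
    unfolding y_def by (simp add: matrix_vector_mul_assoc VVX_inverse)
  then have eq: "u = VV e v *v (TT (VV e v) *v u) + y $ None *\<^sub>R Xvec"
    unfolding VVX_mult TT_mult y_def by simp
  then have "u \<bullet> Xvec = (VV e v *v (TT (VV e v) *v u) + y $ None *\<^sub>R Xvec) \<bullet> Xvec" by simp
  then have "u \<bullet> Xvec = y $ None * real CARD('N + 'N)"
    by (simp add: inner_add_left VV_orth Xvec_inner_Xvec)
  then have "y $ None = (u \<bullet> Xvec) / real CARD('N + 'N)" by simp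
  then show ?thesis using eq by (simp add: algebra_simps)
qed

lemma VV_degenerate:
  assumes "degenerate_config TYPE('N) e Z"
  shows "\<exists>\<zeta>. \<bar>\<zeta>\<bar> \<le> norm Z \<and> VV e v *v Z = \<zeta> *\<^sub>R 1"
proof (intro exI conjI)
  show "\<bar>Z $ last_index\<bar> \<le> norm Z" using component_le_norm_cart by blast
  have "Z $ p = 0" if "p \<in> upper_coords \<union> lower_coords" for p
    using assms that e_ge1[of p] CARD_ge_1 unfolding degenerate_config_def upper_coords_def lower_coords_def by auto
  then have "(VV e v *v Z) $ Inl j = Z $ last_index" "(VV e v *v Z) $ Inr j = Z $ last_index" for j
    unfolding VV_mult by simp_all
  then show "VV e v *v Z = (Z $ last_index) *\<^sub>R 1" by (simp add: vec_eq_iff split_sum_all)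
qed

end

section \<open>Complex form of the reduced system\<close>

lemma norm_vec_mult_le:
  fixes x y :: "real^'n::finite"
  shows "norm (x * y) \<le> norm x * norm y"
proof -
  have "norm (x * y) \<le> norm (norm x *\<^sub>R y)"
  proof (rule norm_le_componentwise_cart)
    fix i
    have "\<bar>x $ i\<bar> * \<bar>y $ i\<bar> \<le> norm x * \<bar>y $ i\<bar>"
      by (intro mult_right_mono component_le_norm_cart) auto
    then show "norm ((x * y) $ i) \<le> norm ((norm x *\<^sub>R y) $ i)" by (simp add: abs_mult)
  qed
  then show ?thesis by simp
qed

lemma tendsto_vec_mult:
  fixes f g :: "'a \<Rightarrow> real^'n::finite"
  assumes "(f \<longlongrightarrow> l) Q" "(g \<longlongrightarrow> m) Q"
  shows "((\<lambda>x. f x * g x) \<longlongrightarrow> l * m) Q"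
  by (rule vec_tendstoI) (use assms in \<open>auto intro!: tendsto_mult tendsto_vec_nth\<close>)

text \<open>Orthogonal projection onto the line spanned by X.\<close>

definition projX :: "real^('N::finite + 'N) \<Rightarrow> real^('N + 'N)" where
  "projX u = ((u \<bullet> Xvec) / real CARD('N + 'N)) *\<^sub>R Xvec"

lemma bounded_linear_projX: "bounded_linear projX"
  unfolding projX_def[abs_def]
  by (intro bounded_linear_scaleR_const bounded_linear_divide bounded_linear_inner_left
      bounded_linear_compose[OF bounded_linear_divide])

lemmas projX_linear_simps = linear_add[OF bounded_linear.linear[OF bounded_linear_projX]]
  linear_diff[OF bounded_linear.linear[OF bounded_linear_projX]]
  linear_scale[OF bounded_linear.linear[OF bounded_linear_projX]]
  linear_neg[OF bounded_linear.linear[OF bounded_linear_projX]]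

lemma projX_Xvec: "projX Xvec = Xvec"
  unfolding projX_def by (simp add: Xvec_inner_Xvec)

lemma projX_one: "projX 1 = 0"
  unfolding projX_def by (simp add: inner_commute[of 1] Xvec_inner_one)

lemma projX_idem: "projX (projX u) = projX u"
  by (simp add: projX_def[of u] projX_linear_simps projX_Xvec)

lemma projX_selfadjoint: "projX u \<bullet> v = u \<bullet> projX v"
  unfolding projX_def by (simp add: inner_commute)

lemma norm_projX_compl: "norm (u - projX u) \<le> norm u"
proof -
  have "projX u \<bullet> projX u = projX u \<bullet> u" using projX_selfadjoint[of "projX u" u] by (simp add: projX_idem)
  then have "(norm (u - projX u))\<^sup>2 = u \<bullet> u - projX u \<bullet> projX u"
    by (simp add: power2_norm_eq_inner inner_diff_left inner_diff_right inner_commute)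
  also have "\<dots> \<le> (norm u)\<^sup>2" by (simp add: power2_norm_eq_inner)
  finally show ?thesis by (rule power2_le_imp_le) simp
qed

lemma norm_projX: "norm (projX u) \<le> norm u"
proof -
  have "projX u \<bullet> projX u = projX u \<bullet> u" using projX_selfadjoint[of "projX u" u] by (simp add: projX_idem)
  then have "norm (projX u) * norm (projX u) = projX u \<bullet> u"
    by (simp add: power2_norm_eq_inner[symmetric] power2_eq_square)
  also have "\<dots> \<le> norm (projX u) * norm u" by (rule norm_cauchy_schwarz)
  finally show ?thesis by (cases "norm (projX u) = 0") auto
qed

text \<open>With \<open>w = (c + 1) + i s\<close> and \<open>\<rho> = |w|\<^sup>2 - 1\<close> (entrywise), the reduced system in complex form is
  \<open>w' = i m - a w \<rho>\<close>, \<open>m' = i (2 m - P m) - a w \<rho>\<close> with the constraint \<open>P m = P w\<close>, where P is the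
  projection onto X. The next two maps are the real and imaginary parts of \<open>m\<close>.\<close>

definition mre :: "real \<Rightarrow> real^'p::finite^('N::finite + 'N) \<Rightarrow> 'p state \<Rightarrow> real^('N + 'N)" where
  "mre a B = (\<lambda>(Z, \<beta>, \<beta>\<^sub>d, \<beta>\<^sub>s, \<gamma>\<^sub>1, \<gamma>\<^sub>2). B *v \<beta>\<^sub>s - (a * \<gamma>\<^sub>1) *\<^sub>R Xvec)"

definition mim :: "real \<Rightarrow> real^'p::finite^('N::finite + 'N) \<Rightarrow> 'p state \<Rightarrow> real^('N + 'N)" where
  "mim a B = (\<lambda>(Z, \<beta>, \<beta>\<^sub>d, \<beta>\<^sub>s, \<gamma>\<^sub>1, \<gamma>\<^sub>2). B *v \<beta>\<^sub>d + (a\<^sup>2 * \<gamma>\<^sub>1 + a * \<gamma>\<^sub>2) *\<^sub>R Xvec)"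

text \<open>The entrywise deviation \<open>\<rho>\<close> of \<open>|w|\<^sup>2\<close> from 1; it vanishes when all points \<open>w\<^sub>j\<close> lie on the unit circle.\<close>

definition defect :: "real \<Rightarrow> real^'p::finite^('N::finite + 'N) \<Rightarrow> 'p state \<Rightarrow> real^('N + 'N)" where
  "defect a B \<xi> = (cvec a B \<xi> + 1)\<^sup>2 + (svec a B \<xi>)\<^sup>2 - 1"

lemmas matrix_vector_linear_simps = matrix_vector_right_distrib matrix_vector_mult_diff_distrib
  matrix_vector_mult_scaleR vec.neg

lemma bounded_linear_state_maps:
  fixes B :: "real^'p::finite^('N::finite + 'N)"
  shows "bounded_linear (cvec a B)" "bounded_linear (svec a B)"
    "bounded_linear (mre a B)" "bounded_linear (mim a B)"
  unfolding linear_conv_bounded_linear[symmetric]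
  by (rule linearI; auto simp: cvec_def svec_def mre_def mim_def matrix_vector_linear_simps algebra_simps)+

text \<open>All that matters about the matrix: its columns are orthogonal to X, the matrix T is a left inverse,
  and the product in the other order is the projection off X.\<close>

locale reduced_system =
  fixes a :: real and B :: "real^'p::finite^('N::finite + 'N)"
  assumes orth: "(B *v x) \<bullet> Xvec = 0"
    and TB: "TT B *v (B *v x) = x"
    and BT: "B *v (TT B *v u) = u - projX u"
begin

lemma projX_B: "projX (B *v x) = 0" by (simp add: projX_def orth)

lemma projX_state:
  "projX (cvec a B \<xi>) = projX (mre a B \<xi>)" "projX (svec a B \<xi>) = projX (mim a B \<xi>)"
  by (cases \<xi>; simp add: cvec_def svec_def mre_def mim_def projX_linear_simps projX_B)+

lemma field_state:
  defines "F \<equiv> reduced_field a B"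
  shows "cvec a B (F \<xi>) = - mim a B \<xi> - a *\<^sub>R ((cvec a B \<xi> + 1) * defect a B \<xi>)" (is ?c)
    and "svec a B (F \<xi>) = mre a B \<xi> - a *\<^sub>R (svec a B \<xi> * defect a B \<xi>)" (is ?s)
    and "mre a B (F \<xi>) = - (2 *\<^sub>R mim a B \<xi> - projX (mim a B \<xi>)) - a *\<^sub>R ((cvec a B \<xi> + 1) * defect a B \<xi>)" (is ?re)
    and "mim a B (F \<xi>) = 2 *\<^sub>R mre a B \<xi> - projX (mre a B \<xi>) - a *\<^sub>R (svec a B \<xi> * defect a B \<xi>)" (is ?im)
proof -
  obtain Z \<beta> \<beta>d \<beta>s \<gamma>1 \<gamma>2 where \<xi>: "\<xi> = (Z, \<beta>, \<beta>d, \<beta>s, \<gamma>1, \<gamma>2)" by (metis prod.exhaust)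
  define U W where "U = UU a B \<xi>" and "W = WW a B \<xi>"
  define Ub Wb where "Ub = (U \<bullet> Xvec) / real CARD('N + 'N)" and "Wb = (W \<bullet> Xvec) / real CARD('N + 'N)"
  have PU: "projX U = Ub *\<^sub>R Xvec" "projX W = Wb *\<^sub>R Xvec" by (simp_all add: projX_def Ub_def Wb_def)
  have b: "1 / real CARD('N + 'N) * (Xvec \<bullet> W) = Wb"
    "1 / real CARD('N + 'N) * (Xvec \<bullet> (U + a *\<^sub>R W)) = Ub + a * Wb"
    by (simp_all add: Ub_def Wb_def inner_commute[of Xvec] inner_add_left add_divide_distrib)
  have F: "F \<xi> = (- (a / 2) *\<^sub>R (TT B *v U), \<beta>d, 2 *\<^sub>R \<beta>s + a *\<^sub>R (TT B *v U),
         - (2 * a) *\<^sub>R \<beta> - 2 *\<^sub>R \<beta>d - (2 * a) *\<^sub>R \<beta>s + a *\<^sub>R (TT B *v W),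
         - a * \<gamma>1 + \<gamma>2 - Wb, (a\<^sup>2 - 1) * \<gamma>1 - a * \<gamma>2 + (Ub + a * Wb))"
    unfolding F_def reduced_field_def \<xi> Let_def prod.case
    unfolding \<xi>[symmetric] U_def[symmetric] W_def[symmetric] b ..
  have U: "U = - (svec a B \<xi> * defect a B \<xi>)"
    by (simp add: U_def UU_def defect_def)
  have W: "W = - ((cvec a B \<xi> + 1) * defect a B \<xi>) + 2 *\<^sub>R (B *v \<beta> + B *v \<beta>s - (a * \<gamma>1) *\<^sub>R Xvec)"
  proof -
    have "cvec a B \<xi> = B *v \<beta> + B *v \<beta>s - (a * \<gamma>1) *\<^sub>R Xvec" by (simp add: cvec_def \<xi>)
    then show ?thesis by (simp only: W_def WW_def defect_def mult_minus_left)
  qed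
  have Pm: "projX (mre a B \<xi>) = - (a * \<gamma>1) *\<^sub>R Xvec" "projX (mim a B \<xi>) = (a\<^sup>2 * \<gamma>1 + a * \<gamma>2) *\<^sub>R Xvec"
    by (simp_all add: \<xi> mre_def mim_def projX_linear_simps projX_B projX_Xvec)
  have W': "(cvec a B \<xi> + 1) * defect a B \<xi> = 2 *\<^sub>R (B *v \<beta> + B *v \<beta>s - (a * \<gamma>1) *\<^sub>R Xvec) - W"
    and U': "svec a B \<xi> * defect a B \<xi> = - U" by (simp_all add: U W)
  have m: "mre a B \<xi> = B *v \<beta>s - (a * \<gamma>1) *\<^sub>R Xvec" "mim a B \<xi> = B *v \<beta>d + (a\<^sup>2 * \<gamma>1 + a * \<gamma>2) *\<^sub>R Xvec"
    by (simp_all add: \<xi> mre_def mim_def)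
  show ?c ?s ?re ?im
    unfolding F W' U' Pm unfolding m
    by (simp_all add: cvec_def svec_def mre_def mim_def matrix_vector_linear_simps BT PU vec_eq_iff power2_eq_square algebra_simps)
qed

text \<open>Off X, the combination \<open>w - m / 2\<close> is conserved up to nonlinear terms; its imaginary part is the
  image of the center variable \<open>- Z\<close> under the matrix.\<close>

lemma center_state:
  assumes "\<xi> = (Z, \<beta>, \<beta>d, \<beta>s, \<gamma>)"
  shows "(svec a B \<xi> - (1/2) *\<^sub>R mim a B \<xi>) - projX (svec a B \<xi> - (1/2) *\<^sub>R mim a B \<xi>) = - (B *v Z)"
    and "(cvec a B \<xi> - (1/2) *\<^sub>R mre a B \<xi>) - projX (cvec a B \<xi> - (1/2) *\<^sub>R mre a B \<xi>) = B *v (\<beta> + (1/2) *\<^sub>R \<beta>s)"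
  by (cases \<gamma>; simp add: assms cvec_def svec_def mre_def mim_def matrix_vector_linear_simps projX_linear_simps
      projX_B projX_Xvec vec_eq_iff algebra_simps)+

lemma tendsto_field: "(reduced_field a B \<longlongrightarrow> reduced_field a B \<xi>) (at \<xi>)"
proof -
  have mv: "((\<lambda>x. A *v f x) \<longlongrightarrow> A *v l) Q" if "(f \<longlongrightarrow> l) Q" for f l Q and A :: "real^'m::finite^'k::finite"
    using bounded_linear.tendsto[OF matrix_vector_mul_bounded_linear that] .
  have id: "((\<lambda>x. x) \<longlongrightarrow> \<xi>) (at \<xi>)" by (rule tendsto_ident_at)
  have c: "((\<lambda>x. cvec a B x) \<longlongrightarrow> cvec a B \<xi>) (at \<xi>)" "((\<lambda>x. svec a B x) \<longlongrightarrow> svec a B \<xi>) (at \<xi>)"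
    using bounded_linear.tendsto[OF bounded_linear_state_maps(1) id]
      bounded_linear.tendsto[OF bounded_linear_state_maps(2) id] .
  have U: "((\<lambda>x. UU a B x) \<longlongrightarrow> UU a B \<xi>) (at \<xi>)" "((\<lambda>x. WW a B x) \<longlongrightarrow> WW a B \<xi>) (at \<xi>)"
    unfolding UU_def WW_def power2_eq_square
    by (intro tendsto_intros tendsto_vec_mult c)+
  have *: "reduced_field a B = (\<lambda>x. (- (a / 2) *\<^sub>R (TT B *v UU a B x), fst (snd (snd x)),
      2 *\<^sub>R fst (snd (snd (snd x))) + a *\<^sub>R (TT B *v UU a B x),
      - (2 * a) *\<^sub>R fst (snd x) - 2 *\<^sub>R fst (snd (snd x)) - (2 * a) *\<^sub>R fst (snd (snd (snd x))) + a *\<^sub>R (TT B *v WW a B x),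
      - a * fst (snd (snd (snd (snd x)))) + snd (snd (snd (snd (snd x)))) - 1 / real CARD('N + 'N) * (Xvec \<bullet> WW a B x),
      (a\<^sup>2 - 1) * fst (snd (snd (snd (snd x)))) - a * snd (snd (snd (snd (snd x))))
        + 1 / real CARD('N + 'N) * (Xvec \<bullet> (UU a B x + a *\<^sub>R WW a B x))))"
    by (rule ext) (simp add: reduced_field_def Let_def split_beta)
  show ?thesis unfolding * by (intro tendsto_intros mv U)
qed

end

section \<open>Equilibria and rotated coordinates\<close>

lemma limit_is_zero_of_field:
  fixes F :: "'s::real_inner \<Rightarrow> 's"
  assumes tr: "trajectory_on F x {0..}" and lim: "(x \<longlongrightarrow> L) at_top" and F: "(F \<longlongrightarrow> F L) (at L)"
  shows "F L = 0"
proof (rule ccontr)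
  assume ne: "F L \<noteq> 0"
  define \<phi> where "\<phi> = (\<lambda>t. x t \<bullet> F L)"
  have "((\<lambda>t. F (x t)) \<longlongrightarrow> F L) at_top"
    using F lim by (metis continuous_within isCont_tendsto_compose)
  then have "((\<lambda>t. F (x t) \<bullet> F L) \<longlongrightarrow> F L \<bullet> F L) at_top" by (intro tendsto_intros)
  moreover have "F L \<bullet> F L / 2 < F L \<bullet> F L" using ne by simp
  ultimately have "\<forall>\<^sub>F t in at_top. F (x t) \<bullet> F L > F L \<bullet> F L / 2" by (rule order_tendstoD(1))
  then obtain T where T: "\<And>t. t \<ge> T \<Longrightarrow> F (x t) \<bullet> F L > F L \<bullet> F L / 2"
    unfolding eventually_at_top_linorder by blast
  have d: "(\<phi> has_real_derivative F (x t) \<bullet> F L) (at t)" if "t > 0" for t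
  proof -
    have "at t within {0..} = at t"
      by (rule at_within_interior) (use that in \<open>simp add: interior_real_atLeast\<close>)
    then have "(x has_vector_derivative F (x t)) (at t)"
      using tr that unfolding trajectory_on_def by (metis atLeast_iff less_imp_le)
    from bounded_linear.has_vector_derivative[OF bounded_linear_inner_left this]
    show ?thesis unfolding \<phi>_def has_real_derivative_iff_has_vector_derivative .
  qed
  have inc: "\<phi> (t + 1) - \<phi> t > F L \<bullet> F L / 2" if t: "t \<ge> max 1 T" for t
  proof -
    obtain s where "t < s" "s < t + 1" "\<phi> (t + 1) - \<phi> t = (t + 1 - t) * (F (x s) \<bullet> F L)"
      using MVT2[of t "t + 1" \<phi> "\<lambda>s. F (x s) \<bullet> F L"] d t by (metis add.commute less_add_one less_le_trans max.bounded_iff zero_less_one)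
    then show ?thesis using T[of s] t by simp
  qed
  have lp: "(\<phi> \<longlongrightarrow> L \<bullet> F L) at_top" unfolding \<phi>_def by (intro tendsto_intros lim)
  moreover have "((\<lambda>t. \<phi> (t + 1)) \<longlongrightarrow> L \<bullet> F L) at_top"
    by (rule filterlim_compose[OF lp]) (rule filterlim_at_top_mono[OF filterlim_ident], simp)
  ultimately have "((\<lambda>t. \<phi> (t + 1) - \<phi> t) \<longlongrightarrow> L \<bullet> F L - L \<bullet> F L) at_top"
    by (intro tendsto_diff)
  then have "((\<lambda>t. \<phi> (t + 1) - \<phi> t) \<longlongrightarrow> 0) at_top" by simp
  moreover have "0 < F L \<bullet> F L / 2" using ne by simp
  ultimately have "\<forall>\<^sub>F t in at_top. \<phi> (t + 1) - \<phi> t < F L \<bullet> F L / 2" by (rule order_tendstoD(2))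
  then obtain N where "\<And>t. t \<ge> N \<Longrightarrow> \<phi> (t + 1) - \<phi> t < F L \<bullet> F L / 2"
    unfolding eventually_at_top_linorder by blast
  from this[of "max N (max 1 T)"] inc[of "max N (max 1 T)"] show False by simp
qed

lemma vector_derivative_within_atLeast:
  assumes "trajectory_on F x {0..}" "0 \<le> t1" "t1 \<le> t"
  shows "(x has_vector_derivative F (x t)) (at t within {t1..})"
  using assms unfolding trajectory_on_def
  by (meson atLeast_iff atLeast_subset_iff has_vector_derivative_within_subset order_trans)

context reduced_system
begin

text \<open>At a degenerate equilibrium all points \<open>w\<^sub>j\<close> coincide, so the configuration is obtained from the
  origin by a rotation with cosine \<open>\<kappa>\<close> and sine \<open>- \<zeta>\<close>.\<close>

lemma degenerate_equilibrium:
  assumes a: "a \<noteq> 0" and eq: "reduced_field a B \<xi> = 0" and \<zeta>: "B *v fst \<xi> = \<zeta> *\<^sub>R 1"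
    and small: "norm (cvec a B \<xi>) < 1/2"
  obtains \<kappa> where "\<kappa> > 1/2" "\<kappa>\<^sup>2 + \<zeta>\<^sup>2 = 1" "cvec a B \<xi> + 1 = \<kappa> *\<^sub>R 1" "svec a B \<xi> = - \<zeta> *\<^sub>R 1"
    "mre a B \<xi> = 0" "mim a B \<xi> = 0"
proof -
  note z = linear_0[OF bounded_linear.linear[OF bounded_linear_state_maps(1)]]
    linear_0[OF bounded_linear.linear[OF bounded_linear_state_maps(2)]]
    linear_0[OF bounded_linear.linear[OF bounded_linear_state_maps(3)]]
    linear_0[OF bounded_linear.linear[OF bounded_linear_state_maps(4)]]
  define w s \<rho> where "w = cvec a B \<xi> + 1" and "s = svec a B \<xi>" and "\<rho> = defect a B \<xi>"
  define \<mu> \<nu> where "\<mu> = (mim a B \<xi> \<bullet> Xvec) / real CARD('N + 'N)" and "\<nu> = (mre a B \<xi> \<bullet> Xvec) / real CARD('N + 'N)"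
  have 1: "mim a B \<xi> = - (a *\<^sub>R (w * \<rho>))" "mre a B \<xi> = a *\<^sub>R (s * \<rho>)"
    "2 *\<^sub>R mim a B \<xi> - projX (mim a B \<xi>) = - (a *\<^sub>R (w * \<rho>))" "2 *\<^sub>R mre a B \<xi> - projX (mre a B \<xi>) = a *\<^sub>R (s * \<rho>)"
    using field_state[of \<xi>] unfolding eq z w_def s_def \<rho>_def by (simp_all add: algebra_simps eq_neg_iff_add_eq_0)
  have P: "mim a B \<xi> = projX (mim a B \<xi>)" "mre a B \<xi> = projX (mre a B \<xi>)"
  proof -
    have "2 *\<^sub>R mim a B \<xi> - projX (mim a B \<xi>) = mim a B \<xi>" "2 *\<^sub>R mre a B \<xi> - projX (mre a B \<xi>) = mre a B \<xi>"
      using 1 by simp_all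
    then show "mim a B \<xi> = projX (mim a B \<xi>)" "mre a B \<xi> = projX (mre a B \<xi>)"
      by (simp_all add: scaleR_2 diff_eq_eq)
  qed
  then have m: "mim a B \<xi> = \<mu> *\<^sub>R Xvec" "mre a B \<xi> = \<nu> *\<^sub>R Xvec"
    unfolding projX_def \<mu>_def \<nu>_def by auto
  have s: "s = - \<zeta> *\<^sub>R 1 + \<mu> *\<^sub>R Xvec"
  proof -
    obtain Z \<beta> \<beta>d \<beta>s \<gamma> where \<xi>: "\<xi> = (Z, \<beta>, \<beta>d, \<beta>s, \<gamma>)" by (metis prod.exhaust)
    have "(s - (1/2) *\<^sub>R mim a B \<xi>) - projX (s - (1/2) *\<^sub>R mim a B \<xi>) = - (\<zeta> *\<^sub>R 1)"
      using center_state(1)[OF \<xi>] \<zeta> unfolding s_def \<xi> by simp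
    moreover have "projX s = mim a B \<xi>" using projX_state(2) P(1) unfolding s_def by simp
    ultimately show ?thesis using P(1) m(1) by (simp add: projX_linear_simps projX_Xvec algebra_simps)
  qed
  have cX: "w \<bullet> Xvec = \<nu> * real CARD('N + 'N)"
  proof -
    have "projX (cvec a B \<xi>) = mre a B \<xi>" using projX_state(1) P(2) by simp
    then have "projX w = \<nu> *\<^sub>R Xvec" unfolding w_def m by (simp add: projX_linear_simps projX_one)
    then have "projX w \<bullet> Xvec = \<nu> * real CARD('N + 'N)" by (simp add: Xvec_inner_Xvec)
    then show ?thesis by (simp add: projX_selfadjoint projX_Xvec)
  qed
  have sX: "s \<bullet> Xvec = \<mu> * real CARD('N + 'N)"
    unfolding s by (simp add: inner_add_left inner_diff_left inner_commute[of 1] Xvec_inner_one Xvec_inner_Xvec)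
  \<comment> \<open>\<open>\<mu> s = - \<nu> w\<close>; pairing this with X gives \<open>\<mu>\<^sup>2 = - \<nu>\<^sup>2\<close>.\<close>
  have "\<mu> *\<^sub>R s = - \<nu> *\<^sub>R w"
  proof (subst vec_eq_iff, rule allI)
    fix i
    have "\<mu> * Xvec $ i = - (a * (w $ i * \<rho> $ i))" "\<nu> * Xvec $ i = a * (s $ i * \<rho> $ i)"
      using 1(1,2) unfolding m by (auto simp: vec_eq_iff)
    then have X: "(\<mu> * s $ i) * Xvec $ i = (- \<nu> * w $ i) * Xvec $ i" by algebra
    have "Xvec $ i \<noteq> 0" by (cases i) simp_all
    from iffD1[OF mult_right_cancel[OF this] X]
    show "(\<mu> *\<^sub>R s) $ i = (- \<nu> *\<^sub>R w) $ i" by simp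
  qed
  then have "(\<mu> *\<^sub>R s) \<bullet> Xvec = (- \<nu> *\<^sub>R w) \<bullet> Xvec" by simp
  then have "(\<mu> * \<mu> + \<nu> * \<nu>) * real CARD('N + 'N) = 0" by (simp add: sX cX algebra_simps)
  then have "\<mu> * \<mu> + \<nu> * \<nu> = 0" by simp
  then have \<mu>\<nu>: "\<mu> = 0" "\<nu> = 0" by (simp_all add: sum_squares_eq_zero_iff)
  have wpos: "w $ i > 1/2" for i
    using component_le_norm_cart[of "cvec a B \<xi>" i] small by (simp add: w_def)
  have s': "s = - \<zeta> *\<^sub>R 1" using s \<mu>\<nu> by simp
  have w2: "(w $ i)\<^sup>2 = 1 - \<zeta>\<^sup>2" for i
  proof -
    have "a * (w $ i * \<rho> $ i) = 0" using 1(1) m(1) \<mu>\<nu> by (auto simp: vec_eq_iff)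
    then have "\<rho> $ i = 0" using a wpos[of i] by simp
    moreover have "\<rho> $ i = (w $ i)\<^sup>2 + (s $ i)\<^sup>2 - 1"
      by (simp add: \<rho>_def defect_def w_def s_def power2_eq_square)
    ultimately show ?thesis unfolding s' by simp
  qed
  have w: "w $ i = sqrt (1 - \<zeta>\<^sup>2)" for i
    using w2[of i] wpos[of i] real_sqrt_unique[of "w $ i"] by simp
  show thesis
  proof (rule that)
    show "1/2 < sqrt (1 - \<zeta>\<^sup>2)" using w wpos by metis
    have "0 \<le> 1 - \<zeta>\<^sup>2" using w2 by (metis zero_le_power2)
    then show "(sqrt (1 - \<zeta>\<^sup>2))\<^sup>2 + \<zeta>\<^sup>2 = 1" by simp
    show "cvec a B \<xi> + 1 = sqrt (1 - \<zeta>\<^sup>2) *\<^sub>R 1"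
      using w unfolding w_def[symmetric] by (simp add: vec_eq_iff)
  qed (use s' m \<mu>\<nu> in \<open>simp_all add: s_def\<close>)
qed

text \<open>Linear coordinates of a displacement from the equilibrium, in the frame rotated by the angle with
  cosine \<open>\<kappa>\<close> and sine \<open>\<sigma>\<close>: \<open>rotp\<close> is the radial and \<open>rotq\<close> the tangential part of \<open>w\<close>, \<open>rota\<close> and
  \<open>rote\<close> are the parts of \<open>m\<close>, \<open>rotr\<close> is \<open>rotp - rota\<close>, whose equation is linear, and
  \<open>rotz\<close> is the center variable.\<close>

definition rotp :: "real \<Rightarrow> real \<Rightarrow> 'p state \<Rightarrow> real^('N + 'N)" where
  "rotp \<kappa> \<sigma> \<xi> = \<kappa> *\<^sub>R cvec a B \<xi> + \<sigma> *\<^sub>R svec a B \<xi>"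
definition rotq :: "real \<Rightarrow> real \<Rightarrow> 'p state \<Rightarrow> real^('N + 'N)" where
  "rotq \<kappa> \<sigma> \<xi> = - \<sigma> *\<^sub>R cvec a B \<xi> + \<kappa> *\<^sub>R svec a B \<xi>"
definition rota :: "real \<Rightarrow> real \<Rightarrow> 'p state \<Rightarrow> real^('N + 'N)" where
  "rota \<kappa> \<sigma> \<xi> = \<kappa> *\<^sub>R mre a B \<xi> + \<sigma> *\<^sub>R mim a B \<xi>"
definition rote :: "real \<Rightarrow> real \<Rightarrow> 'p state \<Rightarrow> real^('N + 'N)" where
  "rote \<kappa> \<sigma> \<xi> = - \<sigma> *\<^sub>R mre a B \<xi> + \<kappa> *\<^sub>R mim a B \<xi>"
definition rotr :: "real \<Rightarrow> real \<Rightarrow> 'p state \<Rightarrow> real^('N + 'N)" where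
  "rotr \<kappa> \<sigma> \<xi> = rotp \<kappa> \<sigma> \<xi> - rota \<kappa> \<sigma> \<xi>"
definition rotz :: "real \<Rightarrow> real \<Rightarrow> 'p state \<Rightarrow> real^('N + 'N)" where
  "rotz \<kappa> \<sigma> \<xi> = (rotq \<kappa> \<sigma> \<xi> - (1/2) *\<^sub>R rote \<kappa> \<sigma> \<xi>) - projX (rotq \<kappa> \<sigma> \<xi> - (1/2) *\<^sub>R rote \<kappa> \<sigma> \<xi>)"

lemmas rot_defs = rotp_def rotq_def rota_def rote_def rotr_def rotz_def

lemma bounded_linear_rot:
  "bounded_linear (rotp \<kappa> \<sigma>)" "bounded_linear (rotq \<kappa> \<sigma>)" "bounded_linear (rota \<kappa> \<sigma>)"
  "bounded_linear (rote \<kappa> \<sigma>)" "bounded_linear (rotr \<kappa> \<sigma>)" "bounded_linear (rotz \<kappa> \<sigma>)"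
proof -
  note b = bounded_linear_state_maps
  show 1: "bounded_linear (rotp \<kappa> \<sigma>)" "bounded_linear (rotq \<kappa> \<sigma>)" "bounded_linear (rota \<kappa> \<sigma>)"
    "bounded_linear (rote \<kappa> \<sigma>)"
    unfolding rot_defs[abs_def]
    by (intro bounded_linear_add bounded_linear_compose[OF bounded_linear_scaleR_right] b)+
  then show "bounded_linear (rotr \<kappa> \<sigma>)" unfolding rotr_def[abs_def] by (intro bounded_linear_sub)
  show "bounded_linear (rotz \<kappa> \<sigma>)" unfolding rotz_def[abs_def]
    by (intro bounded_linear_sub bounded_linear_compose[OF bounded_linear_projX]
      bounded_linear_compose[OF bounded_linear_scaleR_right] 1)
qed

lemma projX_rot: "projX (rotr \<kappa> \<sigma> \<xi>) = 0" "projX (rotq \<kappa> \<sigma> \<xi>) = projX (rote \<kappa> \<sigma> \<xi>)"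
  unfolding rot_defs by (simp_all add: projX_linear_simps projX_state)

lemma rotq_eq: "rotq \<kappa> \<sigma> \<xi> = rotz \<kappa> \<sigma> \<xi> + (1/2) *\<^sub>R (rote \<kappa> \<sigma> \<xi> + projX (rote \<kappa> \<sigma> \<xi>))"
  unfolding rotz_def by (simp add: projX_linear_simps projX_rot vec_eq_iff field_simps)

text \<open>By rotation invariance the equations in the rotated frame do not depend on \<open>\<kappa>\<close> and \<open>\<sigma>\<close>. The
  center equation has no linear term.\<close>

lemma field_rot:
  fixes \<kappa> \<sigma> :: real and \<xi> \<xi>' :: "'p state"
  assumes \<kappa>\<sigma>: "\<kappa>\<^sup>2 + \<sigma>\<^sup>2 = 1"
    and eq: "cvec a B \<xi>' + 1 = \<kappa> *\<^sub>R 1" "svec a B \<xi>' = \<sigma> *\<^sub>R 1" "mre a B \<xi>' = 0" "mim a B \<xi>' = 0"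
  defines "F \<equiv> reduced_field a B"
    and "\<Delta> \<equiv> \<xi> - \<xi>'"
  defines "p \<equiv> rotp \<kappa> \<sigma> \<Delta>" and "q \<equiv> rotq \<kappa> \<sigma> \<Delta>" and "\<eta> \<equiv> rote \<kappa> \<sigma> \<Delta>" and "r \<equiv> rotr \<kappa> \<sigma> \<Delta>"
  defines "\<rho> \<equiv> 2 *\<^sub>R p + p * p + q * q"
  defines "f \<equiv> p * p + q * q + p * \<rho>" and "g \<equiv> q * \<rho>"
  shows "rotp \<kappa> \<sigma> (F \<xi>) = - (2 * a) *\<^sub>R p - \<eta> - a *\<^sub>R f"
    and "rote \<kappa> \<sigma> (F \<xi>) = 2 *\<^sub>R (p - r) - projX p - a *\<^sub>R g"
    and "rotr \<kappa> \<sigma> (F \<xi>) = \<eta> - projX \<eta>"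
    and "rotz \<kappa> \<sigma> (F \<xi>) = - (a / 2) *\<^sub>R (g - projX g)"
proof -
  define w s u v where "w = cvec a B \<xi> + 1" and "s = svec a B \<xi>" and "u = mre a B \<xi>" and "v = mim a B \<xi>"
  define \<alpha> where "\<alpha> = rota \<kappa> \<sigma> \<Delta>"
  note lin = linear_diff[OF bounded_linear.linear[OF bounded_linear_state_maps(1)]]
    linear_diff[OF bounded_linear.linear[OF bounded_linear_state_maps(2)]]
    linear_diff[OF bounded_linear.linear[OF bounded_linear_state_maps(3)]]
    linear_diff[OF bounded_linear.linear[OF bounded_linear_state_maps(4)]]
  have \<kappa>\<sigma>': "\<kappa> * \<kappa> + \<sigma> * \<sigma> = 1" using \<kappa>\<sigma> by (simp add: power2_eq_square)
  have c\<Delta>: "cvec a B \<Delta> = w - \<kappa> *\<^sub>R 1"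
    unfolding \<Delta>_def lin w_def using eq(1) by (simp add: algebra_simps eq_diff_eq)
  have s\<Delta>: "svec a B \<Delta> = s - \<sigma> *\<^sub>R 1" unfolding \<Delta>_def lin s_def eq ..
  have m\<Delta>: "mre a B \<Delta> = u" "mim a B \<Delta> = v" unfolding \<Delta>_def lin u_def v_def eq by simp_all
  have p: "p $ i = \<kappa> * w $ i + \<sigma> * s $ i - 1" for i
    unfolding p_def rotp_def c\<Delta> s\<Delta> using \<kappa>\<sigma>' by (simp add: algebra_simps)
  have q: "q $ i = - \<sigma> * w $ i + \<kappa> * s $ i" for i
    unfolding q_def rotq_def c\<Delta> s\<Delta> by (simp add: algebra_simps)
  have \<eta>: "\<eta> = - \<sigma> *\<^sub>R u + \<kappa> *\<^sub>R v" unfolding \<eta>_def rote_def m\<Delta> ..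
  have \<alpha>: "\<alpha> = \<kappa> *\<^sub>R u + \<sigma> *\<^sub>R v" unfolding \<alpha>_def rota_def m\<Delta> ..
  have r: "r = p - \<alpha>" unfolding r_def rotr_def p_def \<alpha>_def ..
  have \<rho>: "defect a B \<xi> = \<rho>"
  proof (subst vec_eq_iff, rule allI)
    fix i
    have "w $ i * w $ i + s $ i * s $ i - 1 = 2 * p $ i + p $ i * p $ i + q $ i * q $ i"
      unfolding p q using \<kappa>\<sigma>' by algebra
    then show "defect a B \<xi> $ i = \<rho> $ i"
      by (simp add: defect_def w_def[symmetric] s_def[symmetric] \<rho>_def power2_eq_square)
  qed
  have pw: "\<kappa> *\<^sub>R (w * \<rho>) + \<sigma> *\<^sub>R (s * \<rho>) = 2 *\<^sub>R p + f"
  proof (subst vec_eq_iff, rule allI)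
    fix i
    have "\<kappa> * (w $ i * \<rho> $ i) + \<sigma> * (s $ i * \<rho> $ i) = (p $ i + 1) * \<rho> $ i"
      unfolding p by (simp add: algebra_simps)
    then show "(\<kappa> *\<^sub>R (w * \<rho>) + \<sigma> *\<^sub>R (s * \<rho>)) $ i = (2 *\<^sub>R p + f) $ i"
      unfolding f_def by (simp add: algebra_simps) (simp add: \<rho>_def algebra_simps)
  qed
  have qw: "- \<sigma> *\<^sub>R (w * \<rho>) + \<kappa> *\<^sub>R (s * \<rho>) = g"
    unfolding g_def by (simp add: vec_eq_iff q algebra_simps)
  note fs = field_state[of \<xi>, folded F_def, unfolded \<rho>, folded w_def s_def u_def v_def]
  have P\<alpha>: "projX \<alpha> = projX p" using projX_rot(1)[of \<kappa> \<sigma> \<Delta>] r unfolding r_def by (simp add: projX_linear_simps)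
  have Fp: "rotp \<kappa> \<sigma> (F \<xi>) = - \<eta> - a *\<^sub>R (\<kappa> *\<^sub>R (w * \<rho>) + \<sigma> *\<^sub>R (s * \<rho>))"
    unfolding rotp_def fs \<eta> by (simp add: algebra_simps)
  show "rotp \<kappa> \<sigma> (F \<xi>) = - (2 * a) *\<^sub>R p - \<eta> - a *\<^sub>R f" unfolding Fp pw by (simp add: algebra_simps)
  have Fq: "rotq \<kappa> \<sigma> (F \<xi>) = \<alpha> - a *\<^sub>R (- \<sigma> *\<^sub>R (w * \<rho>) + \<kappa> *\<^sub>R (s * \<rho>))"
    unfolding rotq_def fs \<alpha> by (simp add: algebra_simps)
  have Fa: "rota \<kappa> \<sigma> (F \<xi>) = - (2 *\<^sub>R \<eta> - projX \<eta>) - a *\<^sub>R (\<kappa> *\<^sub>R (w * \<rho>) + \<sigma> *\<^sub>R (s * \<rho>))"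
    unfolding rota_def fs \<eta> by (simp add: projX_linear_simps algebra_simps)
  have Fe: "rote \<kappa> \<sigma> (F \<xi>) = 2 *\<^sub>R \<alpha> - projX \<alpha> - a *\<^sub>R (- \<sigma> *\<^sub>R (w * \<rho>) + \<kappa> *\<^sub>R (s * \<rho>))"
    unfolding rote_def fs \<alpha> by (simp add: projX_linear_simps algebra_simps)
  show "rote \<kappa> \<sigma> (F \<xi>) = 2 *\<^sub>R (p - r) - projX p - a *\<^sub>R g" unfolding Fe qw P\<alpha> r by simp
  show "rotr \<kappa> \<sigma> (F \<xi>) = \<eta> - projX \<eta>" unfolding rotr_def Fp Fa by (simp add: algebra_simps scaleR_2)
  show "rotz \<kappa> \<sigma> (F \<xi>) = - (a / 2) *\<^sub>R (g - projX g)"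
    unfolding rotz_def Fq Fe qw by (simp add: projX_linear_simps projX_idem vec_eq_iff algebra_simps)
qed

end

section \<open>Estimates near a degenerate equilibrium\<close>

lemma reduced_system_VV:
  assumes "coord_numbering TYPE('N::finite) e" "zero_sum_basis (v :: nat \<Rightarrow> real^'N)"
  shows "reduced_system (VV e v :: real^'p::finite^('N + 'N))"
proof
  fix x show "(VV e v *v x) \<bullet> Xvec = 0" by (rule VV_orth[OF assms])
next
  fix x show "TT (VV e v) *v (VV e v *v x) = x" using TT_VV[OF assms, of x 0] by simp
next
  fix u show "VV e v *v (TT (VV e v) *v u) = u - projX u" unfolding projX_def by (rule VV_TT[OF assms])
qed

text \<open>The derivative of the graph map vanishes at the origin, so the map is nonexpansive nearby.\<close>

lemma center_manifold_graph:
  fixes F :: "'z::real_normed_vector \<times> 'y::real_normed_vector \<Rightarrow> 'z \<times> 'y"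
  assumes "local_center_manifold F M"
  shows "\<exists>D h r. M = graph_on D h \<and> 0 < r \<and>
    (\<forall>Z\<in>ball 0 r. \<forall>Z'\<in>ball 0 r. norm (h Z - h Z') \<le> norm (Z - Z'))"
proof -
  obtain D h and h' :: "'z \<Rightarrow> 'z \<Rightarrow>\<^sub>L 'y" where M: "M = graph_on D h" and D: "open D" "0 \<in> D"
    and dh: "\<forall>Z\<in>D. (h has_derivative blinfun_apply (h' Z)) (at Z)"
    and ch: "continuous_on D h'" and h0: "h' 0 = 0"
    using assms unfolding local_center_manifold_def by (elim exE conjE) (rule that; assumption)
  have "isCont h' 0" using ch D by (simp add: continuous_on_eq_continuous_at)
  from this[unfolded continuous_at_eps_delta, rule_format, of 1]
  obtain d where d: "d > 0" "\<And>Z. dist Z 0 < d \<Longrightarrow> dist (h' Z) (h' 0) < 1"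
    by auto
  obtain d' where d': "d' > 0" "ball 0 d' \<subseteq> D" using D by (meson open_contains_ball)
  define r where "r = min d d'"
  have r: "r > 0" "ball 0 r \<subseteq> D" using d d' unfolding r_def by auto
  show ?thesis
  proof (rule exI[of _ D], rule exI[of _ h], rule exI[of _ r], intro conjI ballI M r(1))
    fix Z Z' :: 'z assume Z: "Z \<in> ball 0 r" "Z' \<in> ball 0 r"
    have "norm (h Z - h Z') \<le> 1 * norm (Z - Z')"
    proof (rule differentiable_bound[of "ball 0 r" h "\<lambda>Z. blinfun_apply (h' Z)"])
      show "convex (ball (0::'z) r)" by simp
      fix W :: 'z assume W: "W \<in> ball 0 r"
      have "W \<in> D" using W r(2) by blast
      then show "(h has_derivative blinfun_apply (h' W)) (at W within ball 0 r)"
        by (rule has_derivative_at_withinI[OF bspec[OF dh]])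
      have "dist (h' W) (h' 0) < 1" using W unfolding r_def by (intro d(2)) (simp add: dist_commute)
      then show "onorm (blinfun_apply (h' W)) \<le> 1"
        unfolding h0 by (simp add: norm_blinfun.rep_eq[symmetric])
    qed (use Z in auto)
    then show "norm (h Z - h Z') \<le> norm (Z - Z')" by simp
  qed
qed

text \<open>The hypotheses say that the radial and tangential parts \<open>p\<close> and \<open>q\<close> are controlled by the center
  variable \<open>z\<close>; \<open>q * \<rho>\<close> is then quadratic in \<open>z\<close>, and cubic wherever \<open>p\<close> is quadratic.\<close>

lemma nonlinear_bounds:
  fixes p q z :: "real^'n::finite"
  assumes K: "K \<ge> 0" and p: "norm p \<le> K * norm z" and q: "norm q \<le> (1 + K) * norm z"
    and p1: "norm p \<le> 1" and z1: "norm z \<le> 1"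
  defines "\<rho> \<equiv> 2 *\<^sub>R p + p * p + q * q"
  defines "C \<equiv> 2 * (1 + K)\<^sup>2 * (3 + (1 + K)\<^sup>2)"
  shows "norm (p * p + q * q + p * \<rho>) \<le> C * (norm z)\<^sup>2"
    and "norm (q * \<rho>) \<le> C * (norm z)\<^sup>2"
    and "norm (q * \<rho>) \<le> C * norm z * (norm p + (norm z)\<^sup>2)"
proof -
  define k where "k = 1 + K"
  define E where "E = 3 + k\<^sup>2"
  define \<zeta> where "\<zeta> = norm z"
  define y where "y = norm p"
  have nn: "0 \<le> \<zeta>" "0 \<le> y" unfolding \<zeta>_def y_def by simp_all
  have k: "1 \<le> k" unfolding k_def using K by simp
  then have k2: "k \<le> k\<^sup>2" by (simp add: power2_eq_square)
  have E: "E \<ge> 3" unfolding E_def by simp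
  have C: "C = 2 * (k\<^sup>2 * E)" unfolding C_def E_def k_def by simp
  have y\<zeta>: "y \<le> k * \<zeta>" using p nn(1) unfolding y_def k_def \<zeta>_def distrib_right by linarith
  have q': "norm q \<le> k * \<zeta>" using q unfolding k_def \<zeta>_def .
  have sq: "u * w \<le> k\<^sup>2 * \<zeta>\<^sup>2" if "u \<le> k * \<zeta>" "w \<le> k * \<zeta>" "0 \<le> u" "0 \<le> w" for u w
  proof -
    have "u * w \<le> (k * \<zeta>) * (k * \<zeta>)" using that k nn by (intro mult_mono) auto
    then show ?thesis by (simp add: power2_eq_square algebra_simps)
  qed
  have q2: "norm (q * q) \<le> k\<^sup>2 * \<zeta>\<^sup>2"
    by (rule order_trans[OF norm_vec_mult_le sq[OF q' q']]) simp_all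
  have p2: "norm (p * p) \<le> y * y" unfolding y_def by (rule norm_vec_mult_le)
  have yy: "y * y \<le> y" using mult_left_mono[OF p1, of y] nn unfolding y_def by simp
  have "norm \<rho> \<le> norm (2 *\<^sub>R p + p * p) + norm (q * q)"
    unfolding \<rho>_def by (rule norm_triangle_ineq)
  also have "\<dots> \<le> (norm (2 *\<^sub>R p) + norm (p * p)) + norm (q * q)"
    by (intro add_right_mono norm_triangle_ineq)
  also have "\<dots> \<le> (2 * y + y) + k\<^sup>2 * \<zeta>\<^sup>2"
    by (intro add_mono q2 order_trans[OF p2 yy]) (simp add: y_def)
  also have "\<dots> \<le> E * (y + \<zeta>\<^sup>2)"
  proof -
    have "0 \<le> k\<^sup>2 * y" using nn by simp
    then show ?thesis unfolding E_def by (simp add: algebra_simps)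
  qed
  finally have \<rho>: "norm \<rho> \<le> E * (y + \<zeta>\<^sup>2)" .
  have yz: "y + \<zeta>\<^sup>2 \<le> k * \<zeta>"
  proof -
    have "\<zeta> * \<zeta> \<le> \<zeta> * 1" using z1 nn unfolding \<zeta>_def by (intro mult_left_mono) auto
    then show ?thesis using p unfolding y_def[symmetric] \<zeta>_def[symmetric] k_def
      by (simp add: power2_eq_square algebra_simps)
  qed
  have \<rho>': "norm \<rho> \<le> E * (k * \<zeta>)"
    by (rule order_trans[OF \<rho>]) (use E yz in \<open>intro mult_left_mono; simp\<close>)
  have u\<rho>: "norm (u * \<rho>) \<le> k\<^sup>2 * E * \<zeta>\<^sup>2" if u: "norm u \<le> k * \<zeta>" for u :: "real^'n"
  proof -
    have "norm (u * \<rho>) \<le> norm u * norm \<rho>" by (rule norm_vec_mult_le)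
    also have "\<dots> \<le> (k * \<zeta>) * (E * (k * \<zeta>))" using u \<rho>' k nn by (intro mult_mono) auto
    finally show ?thesis by (simp add: power2_eq_square algebra_simps)
  qed
  have k2E: "0 \<le> k\<^sup>2 * E" using E by simp
  show "norm (q * \<rho>) \<le> C * (norm z)\<^sup>2"
  proof -
    have "0 \<le> k\<^sup>2 * E * \<zeta>\<^sup>2" using k2E by simp
    then show ?thesis using u\<rho>[OF q'] unfolding C \<zeta>_def[symmetric] by linarith
  qed
  show "norm (q * \<rho>) \<le> C * norm z * (norm p + (norm z)\<^sup>2)"
  proof -
    have "norm (q * \<rho>) \<le> norm q * norm \<rho>" by (rule norm_vec_mult_le)
    also have "\<dots> \<le> (k * \<zeta>) * (E * (y + \<zeta>\<^sup>2))" using q' \<rho> k nn by (intro mult_mono) auto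
    also have "\<dots> = (k * E) * (\<zeta> * (y + \<zeta>\<^sup>2))" by (simp add: algebra_simps)
    also have "\<dots> \<le> C * (\<zeta> * (y + \<zeta>\<^sup>2))"
    proof (rule mult_right_mono)
      have "k * E \<le> k\<^sup>2 * E" using k2 E by (intro mult_right_mono) auto
      then show "k * E \<le> C" unfolding C using k2E by linarith
    qed (use nn in simp)
    finally show ?thesis unfolding \<zeta>_def y_def by (simp add: mult.assoc)
  qed
  show "norm (p * p + q * q + p * \<rho>) \<le> C * (norm z)\<^sup>2"
  proof -
    have "norm (p * p + q * q + p * \<rho>) \<le> norm (p * p + q * q) + norm (p * \<rho>)"
      by (rule norm_triangle_ineq)
    also have "\<dots> \<le> (norm (p * p) + norm (q * q)) + norm (p * \<rho>)"
      by (intro add_right_mono norm_triangle_ineq)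
    also have "\<dots> \<le> (k\<^sup>2 * \<zeta>\<^sup>2 + k\<^sup>2 * \<zeta>\<^sup>2) + k\<^sup>2 * E * \<zeta>\<^sup>2"
      using sq[OF y\<zeta> y\<zeta>] nn y\<zeta>
      by (intro add_mono q2 u\<rho> order_trans[OF p2]) (auto simp: y_def)
    also have "\<dots> \<le> C * (norm z)\<^sup>2"
    proof -
      have "2 * (k\<^sup>2 * \<zeta>\<^sup>2) \<le> E * (k\<^sup>2 * \<zeta>\<^sup>2)" using E by (intro mult_right_mono) auto
      then show ?thesis unfolding C \<zeta>_def by (simp add: algebra_simps)
    qed
    finally show ?thesis .
  qed
qed

context reduced_system
begin

lemma rot_bounds:
  "\<exists>K0>0. \<forall>\<kappa> \<sigma> \<xi>. norm (cvec a B \<xi>) \<le> K0 * norm \<xi> \<and> (\<bar>\<kappa>\<bar> \<le> 1 \<longrightarrow> \<bar>\<sigma>\<bar> \<le> 1 \<longrightarrow>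
     norm (rotp \<kappa> \<sigma> \<xi>) \<le> 4 * K0 * norm \<xi> \<and> norm (rote \<kappa> \<sigma> \<xi>) \<le> 4 * K0 * norm \<xi> \<and>
     norm (rotr \<kappa> \<sigma> \<xi>) \<le> 4 * K0 * norm \<xi> \<and> norm (rotz \<kappa> \<sigma> \<xi>) \<le> 4 * K0 * norm \<xi>)"
proof -
  have "\<exists>K>0. \<forall>x. norm (f x) \<le> K * norm x" if "bounded_linear f" for f :: "'p state \<Rightarrow> real^('N + 'N)"
    using bounded_linear.pos_bounded[OF that] by (simp add: mult.commute)
  from this[OF bounded_linear_state_maps(1)] this[OF bounded_linear_state_maps(2)]
    this[OF bounded_linear_state_maps(3)] this[OF bounded_linear_state_maps(4)]
  obtain K1 K2 K3 K4 where K: "K1 > 0" "K2 > 0" "K3 > 0" "K4 > 0"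
    "\<And>\<xi>. norm (cvec a B \<xi>) \<le> K1 * norm \<xi>" "\<And>\<xi>. norm (svec a B \<xi>) \<le> K2 * norm \<xi>"
    "\<And>\<xi>. norm (mre a B \<xi>) \<le> K3 * norm \<xi>" "\<And>\<xi>. norm (mim a B \<xi>) \<le> K4 * norm \<xi>"
    by metis
  define K0 where "K0 = max (max K1 K2) (max K3 K4)"
  have le: "K1 \<le> K0" "K2 \<le> K0" "K3 \<le> K0" "K4 \<le> K0" unfolding K0_def by auto
  have b: "norm (cvec a B \<xi>) \<le> K0 * norm \<xi>" "norm (svec a B \<xi>) \<le> K0 * norm \<xi>"
    "norm (mre a B \<xi>) \<le> K0 * norm \<xi>" "norm (mim a B \<xi>) \<le> K0 * norm \<xi>" for \<xi>
    by (rule order_trans[OF K(5) mult_right_mono[OF le(1)]] order_trans[OF K(6) mult_right_mono[OF le(2)]]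
        order_trans[OF K(7) mult_right_mono[OF le(3)]] order_trans[OF K(8) mult_right_mono[OF le(4)]]; simp)+
  have comb: "norm (s *\<^sub>R u + t *\<^sub>R w) \<le> 2 * (K0 * norm \<xi>)"
    if "\<bar>s\<bar> \<le> 1" "\<bar>t\<bar> \<le> 1" "norm u \<le> K0 * norm \<xi>" "norm w \<le> K0 * norm \<xi>"
    for s t and u w :: "real^('N + 'N)" and \<xi> :: "'p state"
  proof -
    have "norm (s *\<^sub>R u + t *\<^sub>R w) \<le> norm (s *\<^sub>R u) + norm (t *\<^sub>R w)" by (rule norm_triangle_ineq)
    also have "\<dots> \<le> 1 * norm u + 1 * norm w"
      unfolding norm_scaleR using that by (intro add_mono mult_right_mono) auto
    finally show ?thesis using that by linarith
  qed
  have "norm (rotp \<kappa> \<sigma> \<xi>) \<le> 4 * K0 * norm \<xi> \<and> norm (rote \<kappa> \<sigma> \<xi>) \<le> 4 * K0 * norm \<xi> \<and>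
     norm (rotr \<kappa> \<sigma> \<xi>) \<le> 4 * K0 * norm \<xi> \<and> norm (rotz \<kappa> \<sigma> \<xi>) \<le> 4 * K0 * norm \<xi>"
    if "\<bar>\<kappa>\<bar> \<le> 1" "\<bar>\<sigma>\<bar> \<le> 1" for \<kappa> \<sigma> \<xi>
  proof -
    have K0n: "0 \<le> K0 * norm \<xi>" using b(1)[of \<xi>] norm_ge_zero order_trans by blast
    have p: "norm (rotp \<kappa> \<sigma> \<xi>) \<le> 2 * (K0 * norm \<xi>)" unfolding rotp_def by (intro comb b that)
    have q: "norm (rotq \<kappa> \<sigma> \<xi>) \<le> 2 * (K0 * norm \<xi>)" unfolding rotq_def by (intro comb b) (use that in simp_all)
    have a: "norm (rota \<kappa> \<sigma> \<xi>) \<le> 2 * (K0 * norm \<xi>)" unfolding rota_def by (intro comb b that)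
    have e: "norm (rote \<kappa> \<sigma> \<xi>) \<le> 2 * (K0 * norm \<xi>)" unfolding rote_def by (intro comb b) (use that in simp_all)
    have r: "norm (rotr \<kappa> \<sigma> \<xi>) \<le> 4 * (K0 * norm \<xi>)"
      using norm_triangle_ineq4[of "rotp \<kappa> \<sigma> \<xi>" "rota \<kappa> \<sigma> \<xi>"] p a unfolding rotr_def by linarith
    have "norm (rotz \<kappa> \<sigma> \<xi>) \<le> norm (rotq \<kappa> \<sigma> \<xi> - (1/2) *\<^sub>R rote \<kappa> \<sigma> \<xi>)"
      unfolding rotz_def by (rule norm_projX_compl)
    also have "\<dots> \<le> norm (rotq \<kappa> \<sigma> \<xi>) + norm ((1/2) *\<^sub>R rote \<kappa> \<sigma> \<xi>)" by (rule norm_triangle_ineq4)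
    also have "\<dots> \<le> 4 * (K0 * norm \<xi>)" using q e K0n by simp
    finally show ?thesis using p e r K0n by simp
  qed
  moreover have "K0 > 0" using K le by linarith
  ultimately show ?thesis using b(1) by blast
qed

lemma rotz_eq:
  "rotz \<kappa> \<sigma> \<xi> = - (\<kappa> *\<^sub>R (B *v fst \<xi>)) - \<sigma> *\<^sub>R (B *v (fst (snd \<xi>) + (1/2) *\<^sub>R fst (snd (snd (snd \<xi>)))))"
proof -
  obtain Z \<beta> \<beta>d \<beta>s \<gamma> where \<xi>: "\<xi> = (Z, \<beta>, \<beta>d, \<beta>s, \<gamma>)" by (metis prod.exhaust)
  define S where "S = svec a B \<xi> - (1/2) *\<^sub>R mim a B \<xi>"
  define T where "T = cvec a B \<xi> - (1/2) *\<^sub>R mre a B \<xi>"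
  have eq: "rotq \<kappa> \<sigma> \<xi> - (1/2) *\<^sub>R rote \<kappa> \<sigma> \<xi> = \<kappa> *\<^sub>R S - \<sigma> *\<^sub>R T"
    unfolding rotq_def rote_def S_def T_def by (simp add: algebra_simps)
  have "rotz \<kappa> \<sigma> \<xi> = \<kappa> *\<^sub>R (S - projX S) - \<sigma> *\<^sub>R (T - projX T)"
    unfolding rotz_def eq by (simp add: projX_linear_simps algebra_simps)
  then show ?thesis
    using center_state[OF \<xi>] unfolding S_def T_def by (simp add: \<xi>)
qed

text \<open>On the cone \<open>norm Y \<le> norm Z\<close> and for a small angle, the rotated center variable dominates a
  fixed multiple of \<open>Z\<close>; \<open>k\<close> and \<open>Kb\<close> are bounds of the matrix from below and above.\<close>

lemma rotz_lower:
  "\<exists>k>0. \<exists>Kb>0. \<forall>\<kappa> \<sigma> \<xi>. \<kappa> \<ge> 1/2 \<longrightarrow> 8 * \<bar>\<sigma>\<bar> * Kb \<le> k \<longrightarrow> norm (snd \<xi>) \<le> norm (fst \<xi>) \<longrightarrow>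
     norm (rotz \<kappa> \<sigma> \<xi>) \<ge> k / 4 * norm (fst \<xi>)"
proof -
  have "inj ((*v) B)" by (rule injI) (metis TB)
  then obtain k where k: "k > 0" "\<And>x. k * norm x \<le> norm (B *v x)"
    using linear_inj_bounded_below_pos[OF matrix_vector_mul_linear] by blast
  obtain Kb where Kb: "Kb > 0" "\<And>x. norm (B *v x) \<le> norm x * Kb"
    using bounded_linear.pos_bounded[OF matrix_vector_mul_bounded_linear[of B]] by blast
  have "norm (rotz \<kappa> \<sigma> \<xi>) \<ge> k / 4 * norm (fst \<xi>)"
    if \<kappa>: "\<kappa> \<ge> 1/2" and \<sigma>: "8 * \<bar>\<sigma>\<bar> * Kb \<le> k" and c: "norm (snd \<xi>) \<le> norm (fst \<xi>)" for \<kappa> \<sigma> \<xi>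
  proof -
    obtain Z \<beta> \<beta>d \<beta>s \<gamma> where \<xi>: "\<xi> = (Z, \<beta>, \<beta>d, \<beta>s, \<gamma>)" by (metis prod.exhaust)
    have \<beta>: "norm \<beta> \<le> norm (snd \<xi>)" "norm \<beta>s \<le> norm (snd \<xi>)"
      unfolding \<xi> snd_conv
      by (rule norm_fst_le)
        (rule order_trans[OF norm_fst_le order_trans[OF norm_snd_le norm_snd_le]])
    have "norm (\<beta> + (1/2) *\<^sub>R \<beta>s) \<le> norm \<beta> + norm ((1/2) *\<^sub>R \<beta>s)" by (rule norm_triangle_ineq)
    also have "\<dots> \<le> 2 * norm Z" using \<beta> c norm_ge_zero[of Z] norm_ge_zero[of \<beta>s] unfolding \<xi> fst_conv norm_scaleR by linarith
    finally have "norm (B *v (\<beta> + (1/2) *\<^sub>R \<beta>s)) \<le> (2 * norm Z) * Kb"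
      by (intro order_trans[OF Kb(2)] mult_right_mono less_imp_le[OF Kb(1)])
    then have "\<bar>\<sigma>\<bar> * norm (B *v (\<beta> + (1/2) *\<^sub>R \<beta>s)) \<le> \<bar>\<sigma>\<bar> * ((2 * norm Z) * Kb)"
      by (rule mult_left_mono) simp
    also have "\<dots> = (8 * \<bar>\<sigma>\<bar> * Kb) * (norm Z / 4)" by simp
    also have "\<dots> \<le> k * (norm Z / 4)" by (rule mult_right_mono[OF \<sigma>]) simp
    finally have 2: "norm (\<sigma> *\<^sub>R (B *v (\<beta> + (1/2) *\<^sub>R \<beta>s))) \<le> k * (norm Z / 4)" by simp
    have "1/2 * (k * norm Z) \<le> \<kappa> * norm (B *v Z)"
      using \<kappa> k by (intro mult_mono) auto
    then have 1: "1/2 * (k * norm Z) \<le> norm (\<kappa> *\<^sub>R (B *v Z))" using \<kappa> by simp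
    have "norm (\<kappa> *\<^sub>R (B *v Z)) \<le> norm (rotz \<kappa> \<sigma> \<xi>) + norm (\<sigma> *\<^sub>R (B *v (\<beta> + (1/2) *\<^sub>R \<beta>s)))"
      using norm_triangle_ineq[of "rotz \<kappa> \<sigma> \<xi>" "\<sigma> *\<^sub>R (B *v (\<beta> + (1/2) *\<^sub>R \<beta>s))"]
      unfolding rotz_eq by (simp add: \<xi>)
    then show ?thesis using 1 2 unfolding \<xi> by simp
  qed
  then show ?thesis using k(1) Kb(1) by blast
qed

end

section \<open>The rate of convergence\<close>

context reduced_system
begin

text \<open>The rate bound, with the center manifold replaced by the graph of a map of Lipschitz constant 1.
  The limit is an equilibrium, and the rotated displacements from it satisfy the
  hypotheses of \<open>slow_center_decay\<close>, with constants that do not depend on the trajectory.\<close>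

lemma degenerate_decay:
  assumes a: "a > 0" and r: "r > 0"
    and h: "\<And>Z Z'. Z \<in> ball 0 r \<Longrightarrow> Z' \<in> ball 0 r \<Longrightarrow> norm (h Z - h Z') \<le> norm (Z - Z')"
  defines "F \<equiv> reduced_field a B"
  obtains \<delta> where "\<delta> > 0" and "\<And>x Zstar \<zeta>. trajectory_on F x {0..} \<Longrightarrow>
      (\<And>t. t \<ge> 0 \<Longrightarrow> snd (x t) = h (fst (x t))) \<Longrightarrow> (\<And>t. t \<ge> 0 \<Longrightarrow> norm (x t) < \<delta>) \<Longrightarrow>
      \<exists>t\<ge>0. \<not> equilibrium F (x t) \<Longrightarrow> ((\<lambda>t. fst (x t)) \<longlongrightarrow> Zstar) at_top \<Longrightarrow>
      \<bar>\<zeta>\<bar> \<le> norm Zstar \<Longrightarrow> B *v Zstar = \<zeta> *\<^sub>R 1 \<Longrightarrow>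
      \<exists>c>0. \<forall>\<^sub>F t in at_top. norm (fst (x t) - Zstar) \<ge> c / sqrt t"
proof -
  obtain K0 where K0: "K0 > 0" and cK: "\<And>\<xi>. norm (cvec a B \<xi>) \<le> K0 * norm \<xi>"
    and rotK: "\<And>\<kappa> \<sigma> \<xi>. \<bar>\<kappa>\<bar> \<le> 1 \<Longrightarrow> \<bar>\<sigma>\<bar> \<le> 1 \<Longrightarrow>
     norm (rotp \<kappa> \<sigma> \<xi>) \<le> 4 * K0 * norm \<xi> \<and> norm (rote \<kappa> \<sigma> \<xi>) \<le> 4 * K0 * norm \<xi> \<and>
     norm (rotr \<kappa> \<sigma> \<xi>) \<le> 4 * K0 * norm \<xi> \<and> norm (rotz \<kappa> \<sigma> \<xi>) \<le> 4 * K0 * norm \<xi>"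
    using rot_bounds by blast
  obtain k Kb where k: "k > 0" and Kb: "Kb > 0"
    and lower: "\<And>\<kappa> \<sigma> \<xi>. \<kappa> \<ge> 1/2 \<Longrightarrow> 8 * \<bar>\<sigma>\<bar> * Kb \<le> k \<Longrightarrow> norm (snd \<xi>) \<le> norm (fst \<xi>) \<Longrightarrow>
     norm (rotz \<kappa> \<sigma> \<xi>) \<ge> k / 4 * norm (fst \<xi>)"
    using rotz_lower by blast
  \<comment> \<open>On the cone a displacement \<open>\<Delta>\<close> has rotated coordinates of norm at most
    \<open>4 K0 norm \<Delta> \<le> 8 K0 norm (fst \<Delta>)\<close>, and \<open>norm (fst \<Delta>) \<le> (4 / k) norm z\<close>.\<close>
  define K where "K = 32 * K0 / k"
  have K: "K \<ge> 0" unfolding K_def using K0 k by simp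
  define C where "C = 2 * (1 + K)\<^sup>2 * (3 + (1 + K)\<^sup>2)"
  have C: "C > 0" unfolding C_def using K by (simp add: add_pos_nonneg)
  have a1: "0 < 128 * (1 + a\<^sup>2)" by (simp add: add_pos_nonneg)
  \<comment> \<open>\<open>m\<close> bounds \<open>norm p + (norm z)\<^sup>2\<close> and is dictated by the smallness condition of \<open>slow_center_decay\<close>.\<close>
  define m where "m = min 1 (1 / (C * (128 * (1 + a\<^sup>2))))"
  have m: "0 < m" "m \<le> 1" "C * m \<le> 1 / (128 * (1 + a\<^sup>2))"
  proof -
    show "0 < m" "m \<le> 1" unfolding m_def using C a1 by simp_all
    have "C * m \<le> C * (1 / (C * (128 * (1 + a\<^sup>2))))"
      unfolding m_def using C by (intro mult_left_mono) auto
    then show "C * m \<le> 1 / (128 * (1 + a\<^sup>2))" using C by simp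
  qed
  define \<delta> where "\<delta> = min (r / 2) (min (k / (8 * Kb)) (m / (16 * K0)))"
  have \<delta>: "\<delta> > 0" "\<delta> < r" "8 * \<delta> * Kb \<le> k" "16 * (K0 * \<delta>) \<le> m"
  proof -
    show "\<delta> > 0" unfolding \<delta>_def using r k Kb K0 m by simp
    show "\<delta> < r" unfolding \<delta>_def using r by linarith
    have "\<delta> \<le> k / (8 * Kb)" unfolding \<delta>_def by linarith
    then show "8 * \<delta> * Kb \<le> k" using Kb by (simp add: field_simps)
    have "\<delta> \<le> m / (16 * K0)" unfolding \<delta>_def by linarith
    then show "16 * (K0 * \<delta>) \<le> m" using K0 by (simp add: field_simps)
  qed
  show thesis
  proof (rule that[OF \<delta>(1)])
    fix x :: "real \<Rightarrow> 'p state" and Zstar :: "real^'p" and \<zeta> :: real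
    assume tr: "trajectory_on F x {0..}" and graph: "\<And>t. t \<ge> 0 \<Longrightarrow> snd (x t) = h (fst (x t))"
      and small: "\<And>t. t \<ge> 0 \<Longrightarrow> norm (x t) < \<delta>" and neq: "\<exists>t\<ge>0. \<not> equilibrium F (x t)"
      and lim: "((\<lambda>t. fst (x t)) \<longlongrightarrow> Zstar) at_top" and \<zeta>: "\<bar>\<zeta>\<bar> \<le> norm Zstar" "B *v Zstar = \<zeta> *\<^sub>R 1"
    define xs where "xs = (Zstar, h Zstar)"
    have ball: "fst (x t) \<in> ball 0 r" if "t \<ge> 0" for t
      using small[OF that] \<delta>(2) norm_fst_le[of "fst (x t)" "snd (x t)"] by simp
    have ev: "\<forall>\<^sub>F t in at_top. norm (fst (x t)) \<le> \<delta> \<and> norm (x t) \<le> \<delta> \<and> t \<ge> 0"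
      using eventually_ge_at_top[of 0]
    proof eventually_elim
      case (elim t)
      then show ?case using small[OF elim] norm_fst_le[of "fst (x t)" "snd (x t)"] by simp
    qed
    have Zs: "norm Zstar \<le> \<delta>"
      by (rule tendsto_upperbound[OF tendsto_norm[OF lim]]) (use ev in \<open>auto elim: eventually_mono\<close>)
    then have Zb: "Zstar \<in> ball 0 r" using \<delta>(2) by simp
    have cone: "norm (snd (x t - xs)) \<le> norm (fst (x t - xs))" if "t \<ge> 0" for t
      using h[OF ball[OF that] Zb] graph[OF that] by (simp add: xs_def)
    have "((\<lambda>t. h (fst (x t))) \<longlongrightarrow> h Zstar) at_top"
    proof (rule Lim_transform_bound[where g = "\<lambda>t. fst (x t) - Zstar", THEN LIM_zero_cancel])
      show "\<forall>\<^sub>F t in at_top. norm (h (fst (x t)) - h Zstar) \<le> norm (fst (x t) - Zstar)"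
        using ev by eventually_elim (use h ball Zb in blast)
      show "((\<lambda>t. fst (x t) - Zstar) \<longlongrightarrow> 0) at_top" using lim by (rule LIM_zero)
    qed
    then have "((\<lambda>t. (fst (x t), h (fst (x t)))) \<longlongrightarrow> xs) at_top"
      unfolding xs_def by (intro tendsto_Pair lim)
    moreover have "\<forall>\<^sub>F t in at_top. (fst (x t), h (fst (x t))) = x t"
      using ev by eventually_elim (use graph in \<open>metis prod.collapse\<close>)
    ultimately have limx: "(x \<longlongrightarrow> xs) at_top" using tendsto_cong by force
    have xs\<delta>: "norm xs \<le> \<delta>"
      by (rule tendsto_upperbound[OF tendsto_norm[OF limx]]) (use ev in \<open>auto elim: eventually_mono\<close>)
    have Fxs: "F xs = 0"
      using limit_is_zero_of_field[OF tr limx] tendsto_field unfolding F_def by blast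
    have "K0 * norm xs \<le> K0 * \<delta>" using xs\<delta> K0 by simp
    then have cs: "norm (cvec a B xs) < 1/2" using cK[of xs] \<delta>(4) m(2) by linarith
    have Bs: "B *v fst xs = \<zeta> *\<^sub>R 1" using \<zeta>(2) by (simp add: xs_def)
    have a0: "a \<noteq> 0" using a by simp
    obtain \<kappa> where \<kappa>: "\<kappa> > 1/2" "\<kappa>\<^sup>2 + \<zeta>\<^sup>2 = 1" and eq: "cvec a B xs + 1 = \<kappa> *\<^sub>R 1"
      "svec a B xs = - \<zeta> *\<^sub>R 1" "mre a B xs = 0" "mim a B xs = 0"
      by (rule degenerate_equilibrium[OF a0 Fxs[unfolded F_def] Bs cs])
    define \<sigma> where "\<sigma> = - \<zeta>"
    have \<kappa>\<sigma>: "\<kappa>\<^sup>2 + \<sigma>\<^sup>2 = 1" unfolding \<sigma>_def using \<kappa> by simp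
    have "\<kappa>\<^sup>2 \<le> 1" "\<sigma>\<^sup>2 \<le> 1"
      using \<kappa>\<sigma> zero_le_power2[of \<kappa>] zero_le_power2[of \<sigma>] by linarith+
    then have k1: "\<bar>\<kappa>\<bar> \<le> 1" "\<bar>\<sigma>\<bar> \<le> 1" by (simp_all add: abs_square_le_1)
    have \<sigma>k: "8 * \<bar>\<sigma>\<bar> * Kb \<le> k"
    proof -
      have "8 * \<bar>\<sigma>\<bar> * Kb \<le> 8 * \<delta> * Kb"
        using \<zeta>(1) Zs Kb unfolding \<sigma>_def by (intro mult_right_mono) auto
      then show ?thesis using \<delta>(3) by linarith
    qed
    define \<Delta> where "\<Delta> t = x t - xs" for t
    define p \<eta> rr z q where "p = (\<lambda>t. rotp \<kappa> \<sigma> (\<Delta> t))" and "\<eta> = (\<lambda>t. rote \<kappa> \<sigma> (\<Delta> t))"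
      and "rr = (\<lambda>t. rotr \<kappa> \<sigma> (\<Delta> t))" and "z = (\<lambda>t. rotz \<kappa> \<sigma> (\<Delta> t))" and "q = (\<lambda>t. rotq \<kappa> \<sigma> (\<Delta> t))"
    define \<rho> where "\<rho> = (\<lambda>t. 2 *\<^sub>R p t + p t * p t + q t * q t)"
    define f g where "f = (\<lambda>t. p t * p t + q t * q t + p t * \<rho> t)" and "g = (\<lambda>t. q t * \<rho> t)"
    have \<Delta>Z: "norm (\<Delta> t) \<le> 2 * norm (fst (\<Delta> t))" if "t \<ge> 0" for t
      using cone[OF that, folded \<Delta>_def] norm_Pair_le[of "fst (\<Delta> t)" "snd (\<Delta> t)", unfolded prod.collapse]
      by linarith
    have \<Delta>\<delta>: "norm (\<Delta> t) \<le> 2 * \<delta>" if "t \<ge> 0" for t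
      using norm_triangle_ineq4[of "x t" xs] small[OF that] xs\<delta> unfolding \<Delta>_def by linarith
    have zlow: "k / 4 * norm (fst (\<Delta> t)) \<le> norm (z t)" if "t \<ge> 0" for t
      unfolding z_def by (rule lower) (use \<kappa> \<sigma>k cone[OF that] in \<open>simp_all add: \<Delta>_def\<close>)
    have Kz: "4 * K0 * norm (\<Delta> t) \<le> K * norm (z t)" if t: "t \<ge> 0" for t
    proof -
      have "4 * K0 * norm (\<Delta> t) \<le> 4 * K0 * (2 * norm (fst (\<Delta> t)))"
        using \<Delta>Z[OF t] K0 by (intro mult_left_mono) auto
      also have "\<dots> = K * (k / 4 * norm (fst (\<Delta> t)))" unfolding K_def using k by simp
      also have "\<dots> \<le> K * norm (z t)" using zlow[OF t] K by (rule mult_left_mono)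
      finally show ?thesis .
    qed
    have b: "norm (p t) \<le> 4 * K0 * norm (\<Delta> t)" "norm (\<eta> t) \<le> 4 * K0 * norm (\<Delta> t)"
      "norm (z t) \<le> 4 * K0 * norm (\<Delta> t)" for t
      using rotK[OF k1, of "\<Delta> t"] unfolding p_def \<eta>_def z_def by auto
    have b\<delta>: "4 * K0 * norm (\<Delta> t) \<le> m / 2" if t: "t \<ge> 0" for t
    proof -
      have "4 * K0 * norm (\<Delta> t) \<le> 4 * K0 * (2 * \<delta>)" using \<Delta>\<delta>[OF t] K0 by (intro mult_left_mono) auto
      then show ?thesis using \<delta>(4) by linarith
    qed
    have p1: "norm (p t) \<le> m / 2" and z1: "norm (z t) \<le> m / 2" if "t \<ge> 0" for t
      using b(1)[of t] b(3)[of t] b\<delta>[OF that] by linarith+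
    have qz: "norm (q t) \<le> (1 + K) * norm (z t)" if t: "t \<ge> 0" for t
    proof -
      have "norm (q t) \<le> norm (z t) + norm ((1/2) *\<^sub>R (\<eta> t + projX (\<eta> t)))"
        unfolding q_def z_def \<eta>_def by (subst rotq_eq) (rule norm_triangle_ineq)
      also have "norm ((1/2) *\<^sub>R (\<eta> t + projX (\<eta> t))) \<le> norm (\<eta> t)"
        using norm_triangle_ineq[of "\<eta> t" "projX (\<eta> t)"] norm_projX[of "\<eta> t"] by simp
      also have "norm (\<eta> t) \<le> K * norm (z t)" using b(2)[of t] Kz[OF t] by linarith
      finally show ?thesis by (simp add: algebra_simps)
    qed
    have bounds: "norm (f t) \<le> C * (norm (z t))\<^sup>2" "norm (g t) \<le> C * (norm (z t))\<^sup>2"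
      "norm (g t) \<le> C * norm (z t) * (norm (p t) + (norm (z t))\<^sup>2)" if t: "t \<ge> 0" for t
    proof -
      have pz: "norm (p t) \<le> K * norm (z t)" using b(1)[of t] Kz[OF t] by linarith
      have le1: "norm (p t) \<le> 1" "norm (z t) \<le> 1" using p1[OF t] z1[OF t] m by linarith+
      show "norm (f t) \<le> C * (norm (z t))\<^sup>2" "norm (g t) \<le> C * (norm (z t))\<^sup>2"
        "norm (g t) \<le> C * norm (z t) * (norm (p t) + (norm (z t))\<^sup>2)"
        unfolding f_def g_def \<rho>_def C_def by (rule nonlinear_bounds[OF K pz qz[OF t] le1])+
    qed
    obtain t1 where t1: "t1 \<ge> 0" "\<not> equilibrium F (x t1)" using neq by blast
    \<comment> \<open>On the cone a vanishing center variable forces the state to be the equilibrium itself.\<close>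
    have z0: "z t1 \<noteq> 0"
    proof
      assume "z t1 = 0"
      then have "k / 4 * norm (fst (\<Delta> t1)) \<le> 0" using zlow[OF t1(1)] by simp
      then have "norm (fst (\<Delta> t1)) \<le> 0" using k by (simp add: mult_le_0_iff)
      then have "norm (\<Delta> t1) \<le> 0" using \<Delta>Z[OF t1(1)] by linarith
      then have "x t1 = xs" unfolding \<Delta>_def by simp
      then show False using t1 Fxs unfolding equilibrium_def by simp
    qed
    have d\<Delta>: "(\<Delta> has_vector_derivative F (x t)) (at t within {t1..})" if "t \<ge> t1" for t
      unfolding \<Delta>_def using vector_derivative_within_atLeast[OF tr t1(1) that]
      by (auto intro!: derivative_eq_intros)
    have eq2: "svec a B xs = \<sigma> *\<^sub>R 1" unfolding \<sigma>_def by (rule eq(2))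
    note fr = field_rot[OF \<kappa>\<sigma> eq(1) eq2 eq(3,4)]
    have "\<exists>c>0. \<forall>\<^sub>F t in at_top. norm (z t) \<ge> c / sqrt t"
    proof (rule slow_center_decay[OF bounded_linear_projX projX_idem projX_selfadjoint a less_imp_le[OF C],
          where p = p and r = rr and \<eta> = \<eta> and z = z and f = f and g = g])
      fix t assume t: "t1 \<le> t"
      then have t0: "t \<ge> 0" using t1 by simp
      show "(p has_vector_derivative - (2 * a) *\<^sub>R p t - \<eta> t - a *\<^sub>R f t) (at t within {t1..})"
        using bounded_linear.has_vector_derivative[OF bounded_linear_rot(1)[of \<kappa> \<sigma>] d\<Delta>[OF t]]
        unfolding F_def fr(1) p_def \<eta>_def f_def \<rho>_def q_def \<Delta>_def .
      show "(\<eta> has_vector_derivative 2 *\<^sub>R (p t - rr t) - projX (p t) - a *\<^sub>R g t) (at t within {t1..})"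
        using bounded_linear.has_vector_derivative[OF bounded_linear_rot(4)[of \<kappa> \<sigma>] d\<Delta>[OF t]]
        unfolding F_def fr(2) p_def \<eta>_def g_def \<rho>_def q_def rr_def \<Delta>_def .
      show "(rr has_vector_derivative \<eta> t - projX (\<eta> t)) (at t within {t1..})"
        using bounded_linear.has_vector_derivative[OF bounded_linear_rot(5)[of \<kappa> \<sigma>] d\<Delta>[OF t]]
        unfolding F_def fr(3) \<eta>_def rr_def \<Delta>_def .
      show "(z has_vector_derivative - (a / 2) *\<^sub>R (g t - projX (g t))) (at t within {t1..})"
        using bounded_linear.has_vector_derivative[OF bounded_linear_rot(6)[of \<kappa> \<sigma>] d\<Delta>[OF t]]
        unfolding F_def fr(4) z_def g_def \<rho>_def p_def q_def \<Delta>_def .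
      show "projX (rr t) = 0" unfolding rr_def by (rule projX_rot)
      show "norm (f t) \<le> C * (norm (z t))\<^sup>2" "norm (g t) \<le> C * (norm (z t))\<^sup>2"
        "norm (g t) \<le> C * norm (z t) * (norm (p t) + (norm (z t))\<^sup>2)"
        by (rule bounds[OF t0])+
      have "(norm (z t))\<^sup>2 \<le> norm (z t) * 1"
        unfolding power2_eq_square using z1[OF t0] m by (intro mult_left_mono) auto
      then have "norm (p t) + (norm (z t))\<^sup>2 \<le> m" using p1[OF t0] z1[OF t0] by linarith
      then have "C * (norm (p t) + (norm (z t))\<^sup>2) \<le> C * m" using C by (intro mult_left_mono) auto
      then show "C * (norm (p t) + (norm (z t))\<^sup>2) \<le> 1 / (128 * (1 + a\<^sup>2))" using m(3) by linarith
    qed (rule z0)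
    then obtain c where c: "c > 0" "\<forall>\<^sub>F t in at_top. norm (z t) \<ge> c / sqrt t" by blast
    have "\<forall>\<^sub>F t in at_top. norm (fst (x t) - Zstar) \<ge> (c / (8 * K0)) / sqrt t"
      using c(2) eventually_ge_at_top[of 0]
    proof eventually_elim
      case (elim t)
      have "4 * K0 * norm (\<Delta> t) \<le> 4 * K0 * (2 * norm (fst (\<Delta> t)))"
        using \<Delta>Z[OF elim(2)] K0 by (intro mult_left_mono) auto
      then have "c / sqrt t \<le> 8 * K0 * norm (fst (\<Delta> t))" using elim(1) b(3)[of t] by linarith
      then have "c / sqrt t \<le> norm (fst (\<Delta> t)) * (8 * K0)" by (simp add: mult.commute)
      then have "(c / sqrt t) / (8 * K0) \<le> norm (fst (\<Delta> t))"
        by (rule iffD2[OF pos_divide_le_eq, rotated]) (use K0 in simp)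
      then show ?case unfolding \<Delta>_def xs_def by (simp add: mult.commute)
    qed
    then show "\<exists>c>0. \<forall>\<^sub>F t in at_top. norm (fst (x t) - Zstar) \<ge> c / sqrt t"
      using c(1) K0 by (intro exI[of _ "c / (8 * K0)"]) simp
  qed
qed

end

theorem mainTheorem5:
  fixes a :: real
    and v :: "nat \<Rightarrow> real^'N::finite"
    and e :: "'p::finite \<Rightarrow> nat"
    and F :: "'p state \<Rightarrow> 'p state"
    and M :: "'p state set"
  assumes "a > 0"
    and "coord_numbering TYPE('N) e"
    and "zero_sum_basis v"
    and "F = reduced_field a (VV e v)"
    and "local_center_manifold F M"
  shows "\<exists>\<delta>>0. \<forall>x Zstar.
           trajectory_on F x {0..} \<and>
           (\<forall>t\<ge>0. x t \<in> M \<and> norm (x t) < \<delta>) \<and>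
           (\<exists>t\<ge>0. \<not> equilibrium F (x t)) \<and>
           ((\<lambda>t. fst (x t)) \<longlongrightarrow> Zstar) at_top \<and>
           degenerate_config TYPE('N) e Zstar \<longrightarrow>
           (\<exists>c>0. \<forall>\<^sub>F t in at_top. norm (fst (x t) - Zstar) \<ge> c / sqrt t)"
proof -
  interpret reduced_system a "VV e v" by (rule reduced_system_VV[OF assms(2,3)])
  obtain D h r where M: "M = graph_on D h" and r: "r > 0"
    and h: "\<And>Z Z'. Z \<in> ball 0 r \<Longrightarrow> Z' \<in> ball 0 r \<Longrightarrow> norm (h Z - h Z') \<le> norm (Z - Z')"
    using center_manifold_graph[OF assms(5)] by blast
  show ?thesis
  proof (rule degenerate_decay[OF assms(1) r h, folded assms(4)])
    fix \<delta> :: real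
    assume \<delta>: "\<delta> > 0" and decay: "\<And>x Zstar \<zeta>. trajectory_on F x {0..} \<Longrightarrow>
      (\<And>t. t \<ge> 0 \<Longrightarrow> snd (x t) = h (fst (x t))) \<Longrightarrow> (\<And>t. t \<ge> 0 \<Longrightarrow> norm (x t) < \<delta>) \<Longrightarrow>
      \<exists>t\<ge>0. \<not> equilibrium F (x t) \<Longrightarrow> ((\<lambda>t. fst (x t)) \<longlongrightarrow> Zstar) at_top \<Longrightarrow>
      \<bar>\<zeta>\<bar> \<le> norm Zstar \<Longrightarrow> VV e v *v Zstar = \<zeta> *\<^sub>R 1 \<Longrightarrow>
      \<exists>c>0. \<forall>\<^sub>F t in at_top. norm (fst (x t) - Zstar) \<ge> c / sqrt t"
    show ?thesis
    proof (rule exI[of _ \<delta>], rule conjI[OF \<delta>], intro allI impI, elim conjE)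
      fix x Zstar
      assume x: "trajectory_on F x {0..}" "\<forall>t\<ge>0. x t \<in> M \<and> norm (x t) < \<delta>"
        "\<exists>t\<ge>0. \<not> equilibrium F (x t)" "((\<lambda>t. fst (x t)) \<longlongrightarrow> Zstar) at_top"
        and deg: "degenerate_config TYPE('N) e Zstar"
      obtain \<zeta> where \<zeta>: "\<bar>\<zeta>\<bar> \<le> norm Zstar" "VV e v *v Zstar = \<zeta> *\<^sub>R 1"
        using VV_degenerate[OF assms(2,3) deg] by blast
      have "snd (x t) = h (fst (x t))" if "t \<ge> 0" for t
        using x(2) that unfolding M graph_on_def by auto
      moreover have "norm (x t) < \<delta>" if "t \<ge> 0" for t using x(2) that by simp
      ultimately show "\<exists>c>0. \<forall>\<^sub>F t in at_top. norm (fst (x t) - Zstar) \<ge> c / sqrt t"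
        by (rule decay[OF x(1) _ _ x(3,4) \<zeta>])
    qed
  qed
qed

end
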